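(* Let $A$ be a finite set and let $\mathbb{P}$ be a probability measure on $A^{\mathbb{N}}$, with coupling matrix $D^\sigma=(D^\sigma_{i,j})_{i,j\in\mathbb{N}}$. Assume that for all $i\in\mathbb{N}$, all $j\geq0$ and all $\sigma\in A^{\mathbb N}$, $$D^\sigma_{i,i+j}\leq\mathbf{1}\{\ell_i(\sigma)\geq j\}+\psi_j,$$ where $\psi_j\geq0$ does not depend on $\sigma$, and $\ell_i:A^{\mathbb{N}}\to[0,\infty]$ are measurable functions (possibly unbounded) whose distribution under $\mathbb{P}$ does not depend on $i$; write $\ell_0$ for a random variable with this common distribution and $\|\psi\|_{\ell^1}:=\sum_{j\ge0}\psi_j$. (1) Let $p\in\mathbb{N}$. If $\mathbb{E}(\ell_0^{2p+\epsilon})<\infty$ for some $\epsilon>0$ and $\|\psi\|_{\ell^1}<\infty$, then there is a constant $C_p\in(0,\infty)$ such that for every positive integer $n$, every $g:A^n\to\mathbb{R}$ and every $t>0$, $$\mathbb{P}\left\{|g-\mathbb{E}g|>t\right\}\leq C_p\,\frac{\|\delta g\|^{2p}_{\ell^2(\mathbb{N})}}{t^{2p}}.$$ (2) Let $0<\varrho<1$. If $\|\psi\|_{\ell^1}<\infty$ and $\|\ell_0\|_{\Phi_\vartheta}<\infty$ for some $\vartheta>\varrho/(1-\varrho)$, then there is a constant $c_{\varrho,\vartheta}\in(0,\infty)$ such that for every positive integer $n$, every $g:A^n\to\mathbb{R}$ and every $t>0$, $$\mathbb{P}\left\{|g-\mathbb{E}g|>t\right\}\leq4\exp\left(-c_{\varrho,\vartheta}\,\frac{t^\varrho}{\|\delta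 g\|^\varrho_{\ell^2(\mathbb{N})}}\right).$$
   Context: $\mathbb{N}=\{1,2,\dots\}$. A function $g:A^n\to\mathbb{R}$ is also viewed as a function on $A^{\mathbb{N}}$ depending only on $\sigma_1,\dots,\sigma_n$; $\mathbb{E}$ is expectation with respect to $\mathbb{P}$. The constants may depend on $\mathbb{P}$, on the law of $\ell_0$ and on $\psi$. Variation: $\delta_i g:=\sup\{|g(\sigma)-g(\sigma')|:\sigma_j=\sigma'_j\ \forall j\neq i\}$; $\delta g=(\delta_jg)_{j\in\mathbb{N}}$ (so $\delta_jg=0$ for $j>n$). If $\delta g=0$ the exponential is read as $0$. Luxembourg norm: for $\varrho>0$ let $\Phi_\varrho(x)=e^{(|x|+h_\varrho)^\varrho}-e^{h_\varrho^\varrho}$, $x\in\mathbb{R}$, with $h_\varrho=((1-\varrho)/\varrho)^{1/\varrho}$ if $0<\varrho<1$ and $h_\varrho=0$ otherwise; for a random variable $Z$, $\|Z\|_{\Phi_\varrho}=\inf\{\lambda>0:\mathbb{E}(\Phi_\varrho(Z/\lambda))\leq1\}$. Coupling matrix: fix versions of the conditional distributions of the future coordinates given finitely many past ones. For $\sigma\in A^{\mathbb{N}}$, $i\in\mathbb{N}$, $a,b\in A$, let $\mathbb{P}^{\sigma}_{i,a,b}$ (depending on $\sigma$ only through $\sigma_1,\dots,\sigma_{i-1}$) be the maximal coupling of $\mathbb{P}(d\eta_{\geq i+1}\mid\sigma_1,\dots,\sigma_{i-1},\sigma_i=a)$ and $\mathbb{P}(d\eta_{\geq i+1}\mid\sigma_1,\dots,\sigma_{i-1},\sigma_i=b)$,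 i.e. a (fixed choice of) joint law of a pair $(\sigma^{(1)}_{\ge i+1},\sigma^{(2)}_{\ge i+1})$ with these two marginals for which the probability that the two components coincide is as large as possible. Then $D^\sigma$ is the upper-triangular matrix with $D^\sigma_{ii}:=1$, $D^\sigma_{i,i+j}:=\max_{a,b\in A}\mathbb{P}^{\sigma}_{i,a,b}\{\sigma^{(1)}_{i+j}\neq\sigma^{(2)}_{i+j}\}$ for $j\geq1$, and $D^\sigma_{i,k}=0$ for $k<i$. *)

theory Defs
  imports "HOL-Probability.Probability"
begin

text \<open>
  Sites are numbered from 0, so a configuration is a function \<open>nat \<Rightarrow> 'a\<close>, the past of site \<open>i\<close>
  consists of the coordinates \<open>j < i\<close>, and a function on \<open>A\<^sup>n\<close> is a function of the
  coordinates \<open>j < n\<close>.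
\<close>

definition coord_space :: "nat set \<Rightarrow> (nat \<Rightarrow> 'a) measure" where
  "coord_space I = PiM I (\<lambda>_. count_space UNIV)"

definition agree_below :: "nat \<Rightarrow> (nat \<Rightarrow> 'a) \<Rightarrow> (nat \<Rightarrow> 'a) \<Rightarrow> bool" where
  "agree_below n \<sigma> \<sigma>' \<longleftrightarrow> (\<forall>j<n. \<sigma> j = \<sigma>' j)"

definition local_fun :: "nat \<Rightarrow> ((nat \<Rightarrow> 'a) \<Rightarrow> real) \<Rightarrow> bool" where
  "local_fun n g \<longleftrightarrow> (\<forall>\<sigma> \<sigma>'. agree_below n \<sigma> \<sigma>' \<longrightarrow> g \<sigma> = g \<sigma>')"

definition variation :: "((nat \<Rightarrow> 'a) \<Rightarrow> real) \<Rightarrow> nat \<Rightarrow> real" where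
  "variation g i = (SUP (\<sigma>, \<sigma>') \<in> {(\<sigma>, \<sigma>'). \<forall>j. j \<noteq> i \<longrightarrow> \<sigma> j = \<sigma>' j}. \<bar>g \<sigma> - g \<sigma>'\<bar>)"

definition ell2_norm :: "(nat \<Rightarrow> real) \<Rightarrow> real" where
  "ell2_norm x = sqrt (\<Sum>j. (x j)\<^sup>2)"

text \<open>
  Extension to \<open>[0,\<infinity>]\<close> of a nonnegative function on \<open>[0,\<infinity>)\<close> that tends to \<open>\<infinity>\<close> at \<open>\<infinity>\<close>.
\<close>

definition extend_ennreal :: "(real \<Rightarrow> real) \<Rightarrow> ennreal \<Rightarrow> ennreal" where
  "extend_ennreal f x = (if x = \<infinity> then \<infinity> else ennreal (f (enn2real x)))"

definition young_shift :: "real \<Rightarrow> real" where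
  "young_shift r = (if 0 < r \<and> r < 1 then ((1 - r) / r) powr (1 / r) else 0)"

definition young_fun :: "real \<Rightarrow> real \<Rightarrow> real" where
  "young_fun r x = exp ((\<bar>x\<bar> + young_shift r) powr r) - exp (young_shift r powr r)"

text \<open>
  The norm is stated for \<open>[0,\<infinity>]\<close>-valued random variables; the infimum over
  the empty set is \<open>\<infinity>\<close>, in particular if the variable is infinite with positive probability.
\<close>

definition luxembourg_norm :: "'b measure \<Rightarrow> real \<Rightarrow> ('b \<Rightarrow> ennreal) \<Rightarrow> ennreal" where
  "luxembourg_norm M r Z =
     Inf {ennreal s | s. 0 < s \<and> (\<integral>\<^sup>+\<omega>. extend_ennreal (young_fun r) (Z \<omega> / ennreal s) \<partial>M) \<le> 1}"

text \<open>
  \<open>K i \<sigma>\<close> is the law of the coordinates \<open>j \<ge> i\<close> given the values \<open>\<sigma> j\<close> of the coordinates \<open>j < i\<close>.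
  The alphabet being finite, it is determined by elementary conditional
  probabilities for pasts of positive probability, and is an arbitrary probability measure
  for the other pasts.
\<close>

definition conditional_versions ::
  "(nat \<Rightarrow> 'a) measure \<Rightarrow> (nat \<Rightarrow> (nat \<Rightarrow> 'a) \<Rightarrow> (nat \<Rightarrow> 'a) measure) \<Rightarrow> bool" where
  "conditional_versions P K \<longleftrightarrow>
     (\<forall>i \<sigma>. prob_space (K i \<sigma>) \<and> sets (K i \<sigma>) = sets (coord_space {i..})) \<and>
     (\<forall>i \<sigma> \<sigma>'. agree_below i \<sigma> \<sigma>' \<longrightarrow> K i \<sigma> = K i \<sigma>') \<and>
     (\<forall>i \<sigma>. \<P>(\<eta> in P. agree_below i \<eta> \<sigma>) > 0 \<longrightarrow>
        (\<forall>B \<in> sets (coord_space {i..}).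
           measure (K i \<sigma>) B = \<P>(\<eta> in P. restrict \<eta> {i..} \<in> B \<bar> agree_below i \<eta> \<sigma>)))"

definition is_coupling :: "'c measure \<Rightarrow> 'c measure \<Rightarrow> ('c \<times> 'c) measure \<Rightarrow> bool" where
  "is_coupling \<mu> \<nu> \<gamma> \<longleftrightarrow>
     sets \<gamma> = sets (\<mu> \<Otimes>\<^sub>M \<nu>) \<and> distr \<gamma> \<mu> fst = \<mu> \<and> distr \<gamma> \<nu> snd = \<nu>"

definition is_maximal_coupling :: "'c measure \<Rightarrow> 'c measure \<Rightarrow> ('c \<times> 'c) measure \<Rightarrow> bool" where
  "is_maximal_coupling \<mu> \<nu> \<gamma> \<longleftrightarrow>
     is_coupling \<mu> \<nu> \<gamma> \<and>
     (\<forall>\<gamma>'. is_coupling \<mu> \<nu> \<gamma>' \<longrightarrow> \<P>(\<omega> in \<gamma>'. fst \<omega> = snd \<omega>) \<le> \<P>(\<omega> in \<gamma>. fst \<omega> = snd \<omega>))"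

text \<open>
  The coincidence event is measurable for the couplings used below, so its \<open>measure\<close> is not
  the default value 0.
\<close>

lemma sets_coincidence:
  assumes "sets \<gamma> = sets (coord_space I \<Otimes>\<^sub>M coord_space I)"
  shows "{\<omega> \<in> space \<gamma>. fst \<omega> = (snd \<omega> :: nat \<Rightarrow> 'a :: finite)} \<in> sets \<gamma>"
proof -
  let ?M = "coord_space I \<Otimes>\<^sub>M coord_space I :: ((nat \<Rightarrow> 'a) \<times> (nat \<Rightarrow> 'a)) measure"
  have eq: "{\<omega> \<in> space ?M. fst \<omega> = snd \<omega>} = {\<omega> \<in> space ?M. \<forall>k\<in>I. fst \<omega> k = snd \<omega> k}"
    by (auto simp: coord_space_def space_pair_measure space_PiM PiE_def extensional_def fun_eq_iff)
  have "{\<omega> \<in> space ?M. \<forall>k\<in>I. fst \<omega> k = snd \<omega> k} \<in> sets ?M"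
    unfolding coord_space_def by measurable
  then show ?thesis
    using assms eq sets_eq_imp_space_eq[OF assms] by simp
qed

text \<open>
  \<open>Q i \<sigma> a b\<close> is the chosen maximal coupling of the laws of the coordinates \<open>j > i\<close>
  given the past of \<open>i\<close> under \<open>\<sigma>\<close> and the value \<open>a\<close>, respectively \<open>b\<close>, at \<open>i\<close>.
\<close>

definition maximal_coupling_family ::
  "(nat \<Rightarrow> (nat \<Rightarrow> 'a) \<Rightarrow> (nat \<Rightarrow> 'a) measure) \<Rightarrow>
   (nat \<Rightarrow> (nat \<Rightarrow> 'a) \<Rightarrow> 'a \<Rightarrow> 'a \<Rightarrow> ((nat \<Rightarrow> 'a) \<times> (nat \<Rightarrow> 'a)) measure) \<Rightarrow> bool" where
  "maximal_coupling_family K Q \<longleftrightarrow>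
     (\<forall>i \<sigma> a b. is_maximal_coupling (K (Suc i) (\<sigma>(i := a))) (K (Suc i) (\<sigma>(i := b))) (Q i \<sigma> a b)) \<and>
     (\<forall>i \<sigma> \<sigma>' a b. agree_below i \<sigma> \<sigma>' \<longrightarrow> Q i \<sigma> a b = Q i \<sigma>' a b)"

definition coupling_matrix ::
  "(nat \<Rightarrow> (nat \<Rightarrow> 'a::finite) \<Rightarrow> 'a \<Rightarrow> 'a \<Rightarrow> ((nat \<Rightarrow> 'a) \<times> (nat \<Rightarrow> 'a)) measure) \<Rightarrow>
   (nat \<Rightarrow> 'a) \<Rightarrow> nat \<Rightarrow> nat \<Rightarrow> real" where
  "coupling_matrix Q \<sigma> i k =
     (if k < i then 0
      else if k = i then 1
      else MAX (a, b) \<in> UNIV. \<P>(\<omega> in Q i \<sigma> a b. fst \<omega> k \<noteq> snd \<omega> k))"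

definition controlled_by ::
  "(nat \<Rightarrow> (nat \<Rightarrow> 'a::finite) \<Rightarrow> 'a \<Rightarrow> 'a \<Rightarrow> ((nat \<Rightarrow> 'a) \<times> (nat \<Rightarrow> 'a)) measure) \<Rightarrow>
   (nat \<Rightarrow> (nat \<Rightarrow> 'a) \<Rightarrow> ennreal) \<Rightarrow> (nat \<Rightarrow> real) \<Rightarrow> bool" where
  "controlled_by Q L \<psi> \<longleftrightarrow>
     (\<forall>i j \<sigma>. coupling_matrix Q \<sigma> i (i + j) \<le> of_bool (L i \<sigma> \<ge> of_nat j) + \<psi> j)"

definition common_law ::
  "(nat \<Rightarrow> 'a) measure \<Rightarrow> (nat \<Rightarrow> (nat \<Rightarrow> 'a) \<Rightarrow> ennreal) \<Rightarrow> 'b measure \<Rightarrow> ('b \<Rightarrow> ennreal) \<Rightarrow> bool" where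
  "common_law P L M L0 \<longleftrightarrow>
     (\<forall>i. L i \<in> borel_measurable P \<and> distr P borel (L i) = distr M borel L0)"

end

(*
  Write S = g - E g and let d_i be the i-th entry of D^\<sigma> \<delta>g.  Conditioning on \<sigma>_0, ..., \<sigma>_{i-1} turns S
  into a martingale whose i-th increment is bounded, by coupling, by the predictable quantity d_i.
  Hence exp (l S - l^2 B) has expectation at most 1, where B = \<Sum>_i d_i^2, and
  P(|S| > t) \<le> 2 exp (-t^2 / (4 v)) + P(B > v) for every v > 0.

  By the Cauchy-Schwarz inequality with summable weights w_j, B is at most a constant multiple of
  |\<delta>g|^2 (1 + Z), where Z is a subconvex combination of the variables 1{l_i \<ge> j} / w_j^2.
  Jensen's inequality for a convex function \<phi> therefore bounds E \<phi>(Z) in terms of the common law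
  of the l_i only, uniformly in n.  Take \<phi> a power slightly above p in the polynomial case, using the
  moment of order 2p + \<epsilon>, and a stretched exponential in the other case; then choose v as
  a suitable power of t.
*)
theory Submission
  imports Defs
begin

section \<open>Elementary inequalities\<close>

text \<open>The functions \<open>L i\<close> may depend on the whole configuration, so they cannot
  serve as predictable bounds. The martingale argument therefore keeps the coupling matrix itself,
  whose row \<open>i\<close> depends only on the past of \<open>i\<close>; the indicators enter
  later, when P(B > v) is estimated. The obstacle there is that only the law of each single
  \<open>L i\<close> is known, not their joint law. Regrouped by columns k = i + j, the weights
  (\<delta>_k g)^2 w_j have total mass at most |\<delta>g|^2 * \<open>suminf w\<close>, so Jensen's
  inequality needs only r_j = P(l_0 \<ge> j), and no union bound over sites costs a factor n. The
  weights w must be summable while r_j * \<phi>(1 / w_j^2) stays bounded; the strict gaps in the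
  integrability assumptions leave room for both. Enlarging v weakens the exponential term but
  shrinks P(B > v). In units s = t / |\<delta>g|, bounding Z by a multiple of z = s^(2 - \<eta>)
  turns the first term into exp (- c s^\<eta>). As the alphabet is finite, local functions are
  finite sums over words, and conditional expectations are quotients over cylinders.\<close>

lemma exp_le_add_exp_square: "exp (x::real) \<le> x + exp (x\<^sup>2)"
proof -
  consider "x > 1" | "0 \<le> x" "x \<le> 1" | "-1 \<le> x" "x \<le> 0" | "x < -1" by linarith
  then show ?thesis
  proof cases
    case 1
    then have "x \<le> x\<^sup>2" by (simp add: power2_eq_square)
    with 1 show ?thesis by (smt (verit) exp_le_cancel_iff)
  next
    case 2
    have "exp x \<le> 1 + x + x\<^sup>2" using exp_bound[OF 2] by simp
    with exp_ge_add_one_self[of "x\<^sup>2"] show ?thesis by linarith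
  next
    case 3
    have "exp x \<le> 1 + x + x\<^sup>2"
    proof -
      have "exp x * (1 - x) \<le> exp x * exp (- x)"
        using exp_ge_add_one_self[of "- x"] by (intro mult_left_mono) auto
      also have "\<dots> = 1" by (simp flip: exp_add)
      also have "1 \<le> (1 + x + x\<^sup>2) * (1 - x)"
      proof -
        have "x ^ 3 \<le> 0" using 3 by (simp add: power_le_zero_eq)
        moreover have "(1 + x + x\<^sup>2) * (1 - x) = 1 - x ^ 3" by algebra
        ultimately show ?thesis by linarith
      qed
      finally show ?thesis using 3 by simp
    qed
    with exp_ge_add_one_self[of "x\<^sup>2"] show ?thesis by linarith
  next
    case 4
    then have "- x * 1 \<le> - x * - x" by (intro mult_left_mono) auto
    then have "- x \<le> x\<^sup>2" by (simp add: power2_eq_square)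
    moreover have "exp x \<le> 1" using 4 by simp
    ultimately show ?thesis using exp_ge_add_one_self[of "x\<^sup>2"] by linarith
  qed
qed

text \<open>A Hoeffding-type bound obtained from \<open>exp_le_add_exp_square\<close>: the linear
  term averages to zero, and no smallness of l * d is required. The weights are not normalised and
  \<open>osc\<close> asks only for positive ones, because they will be the masses of sibling
  cylinders, and \<open>cyl_mean\<close> is junk on a null cylinder.\<close>

lemma weighted_exp_le:
  fixes p x :: "'b \<Rightarrow> real"
  assumes fin: "finite A" and p: "\<And>a. a \<in> A \<Longrightarrow> 0 \<le> p a"
    and mean: "(\<Sum>a\<in>A. p a * x a) = (\<Sum>a\<in>A. p a) * m"
    and osc: "\<And>a b. a \<in> A \<Longrightarrow> b \<in> A \<Longrightarrow> 0 < p a \<Longrightarrow> 0 < p b \<Longrightarrow> \<bar>x a - x b\<bar> \<le> d"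
  shows "(\<Sum>a\<in>A. p a * exp (l * (x a - m))) \<le> (\<Sum>a\<in>A. p a) * exp (l\<^sup>2 * d\<^sup>2)"
proof -
  \<comment> \<open>As m is the weighted mean of x, the product of x a - m with the total mass is
    the weighted sum of the differences x a - x b, each at most d.\<close>
  have dev: "\<bar>x a - m\<bar> \<le> d" if a: "a \<in> A" "0 < p a" for a
  proof -
    let ?s = "\<Sum>b\<in>A. p b"
    have s: "0 < ?s" using a fin p by (meson sum_pos2)
    have "\<bar>?s * (x a - m)\<bar> = \<bar>\<Sum>b\<in>A. p b * (x a - x b)\<bar>"
      using mean by (simp add: right_diff_distrib sum_subtractf sum_distrib_right)
    also have "\<dots> \<le> (\<Sum>b\<in>A. p b * d)"
    proof (intro order_trans[OF sum_abs] sum_mono)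
      fix b assume b: "b \<in> A"
      show "\<bar>p b * (x a - x b)\<bar> \<le> p b * d"
        using osc[OF a(1) b a(2)] p[OF b] by (cases "p b = 0") (auto simp: abs_mult)
    qed
    finally show ?thesis using s by (simp add: abs_mult flip: sum_distrib_right)
  qed
  have "(\<Sum>a\<in>A. p a * exp (l * (x a - m)))
      \<le> (\<Sum>a\<in>A. p a * (l * (x a - m)) + p a * exp (l\<^sup>2 * d\<^sup>2))"
  proof (rule sum_mono)
    fix a assume a: "a \<in> A"
    show "p a * exp (l * (x a - m)) \<le> p a * (l * (x a - m)) + p a * exp (l\<^sup>2 * d\<^sup>2)"
    proof (cases "p a = 0")
      case False
      then have "0 < p a" using p[OF a] by simp
      have "(x a - m)\<^sup>2 \<le> d\<^sup>2"
        using dev[OF a \<open>0 < p a\<close>] by (metis abs_ge_zero power2_abs power_mono)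
      then have "exp ((l * (x a - m))\<^sup>2) \<le> exp (l\<^sup>2 * d\<^sup>2)"
        by (simp add: power_mult_distrib mult_left_mono)
      then have "exp (l * (x a - m)) \<le> l * (x a - m) + exp (l\<^sup>2 * d\<^sup>2)"
        using exp_le_add_exp_square[of "l * (x a - m)"] by linarith
      from mult_left_mono[OF this, of "p a"] \<open>0 < p a\<close> show ?thesis by (simp add: distrib_left)
    qed simp
  qed
  also have "\<dots> = l * ((\<Sum>a\<in>A. p a * x a) - (\<Sum>a\<in>A. p a) * m) + (\<Sum>a\<in>A. p a) * exp (l\<^sup>2 * d\<^sup>2)"
    by (simp add: sum.distrib sum_distrib_left sum_distrib_right sum_subtractf algebra_simps)
  finally show ?thesis using mean by simp
qed

text \<open>Jensen's inequality with the missing mass placed at the point 0, represented by the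
  extra index \<open>None\<close>. In \<open>convex_combination_tail\<close> the mass falls short of
  1 because the inner sums are truncated at j \<le> k.\<close>

lemma convex_on_subweighted_sum:
  fixes c y :: "'b \<Rightarrow> real"
  assumes "finite A" "convex_on {0..} f"
    and "\<And>a. a \<in> A \<Longrightarrow> 0 \<le> c a" "\<And>a. a \<in> A \<Longrightarrow> 0 \<le> y a" "(\<Sum>a\<in>A. c a) \<le> 1"
  shows "f (\<Sum>a\<in>A. c a * y a) \<le> (1 - (\<Sum>a\<in>A. c a)) * f 0 + (\<Sum>a\<in>A. c a * f (y a))"
proof -
  let ?S = "insert None (Some ` A)"
  let ?c = "\<lambda>u. case u of None \<Rightarrow> 1 - (\<Sum>a\<in>A. c a) | Some a \<Rightarrow> c a"
  let ?y = "\<lambda>u. case u of None \<Rightarrow> 0 | Some a \<Rightarrow> y a"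
  have sum_S: "(\<Sum>u\<in>?S. h u) = h None + (\<Sum>a\<in>A. h (Some a))" for h :: "'b option \<Rightarrow> real"
    using assms(1) by (subst sum.insert) (auto simp: sum.reindex)
  have "f (\<Sum>u\<in>?S. ?c u *\<^sub>R ?y u) \<le> (\<Sum>u\<in>?S. ?c u * f (?y u))"
    using assms by (intro convex_on_sum[where C = "{0..}"]) (auto simp: sum_S)
  then show ?thesis by (simp add: sum_S)
qed

section \<open>Local functions and their variation\<close>

text \<open>A finite range keeps the supremum over a bounded set; a real-valued \<open>SUP\<close>
  carries no information otherwise.\<close>

lemma variation_nonneg_le:
  assumes "finite (range g)"
  shows "\<And>i. 0 \<le> variation g i"
    and "\<And>i \<sigma> \<sigma>'. (\<And>j. j \<noteq> i \<Longrightarrow> \<sigma> j = \<sigma>' j) \<Longrightarrow> \<bar>g \<sigma> - g \<sigma>'\<bar> \<le> variation g i"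
proof -
  show le: "\<bar>g \<sigma> - g \<sigma>'\<bar> \<le> variation g i" if "\<And>j. j \<noteq> i \<Longrightarrow> \<sigma> j = \<sigma>' j" for i \<sigma> \<sigma>'
  proof -
    have "finite ((\<lambda>(x, y). \<bar>x - y\<bar>) ` (range g \<times> range g))" using assms by blast
    then have "finite ((\<lambda>(\<sigma>, \<sigma>'). \<bar>g \<sigma> - g \<sigma>'\<bar>) ` {(\<sigma>, \<sigma>'). \<forall>j. j \<noteq> i \<longrightarrow> \<sigma> j = \<sigma>' j})"
      by (rule finite_subset[rotated]) auto
    then have "bdd_above ((\<lambda>(\<sigma>, \<sigma>'). \<bar>g \<sigma> - g \<sigma>'\<bar>) ` {(\<sigma>, \<sigma>'). \<forall>j. j \<noteq> i \<longrightarrow> \<sigma> j = \<sigma>' j})"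
      by simp
    moreover have "(\<sigma>, \<sigma>') \<in> {(\<sigma>, \<sigma>'). \<forall>j. j \<noteq> i \<longrightarrow> \<sigma> j = \<sigma>' j}" using that by simp
    ultimately show ?thesis unfolding variation_def by (rule cSUP_upper2) simp
  qed
  show "0 \<le> variation g i" for i
    using le[of i undefined undefined] by simp
qed

lemma agree_below_Suc_upd:
  "agree_below (Suc i) \<eta> (\<sigma>(i := a)) \<longleftrightarrow> agree_below i \<eta> \<sigma> \<and> \<eta> i = a"
  by (auto simp: agree_below_def less_Suc_eq)

lemma local_funD: "local_fun n f \<Longrightarrow> agree_below n \<sigma> \<sigma>' \<Longrightarrow> f \<sigma> = f \<sigma>'"
  by (simp add: local_fun_def)

lemma local_fun_mono: "local_fun m f \<Longrightarrow> m \<le> n \<Longrightarrow> local_fun n f"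
  by (auto simp: local_fun_def agree_below_def)

text \<open>Extensional functions are canonical representatives: each cylinder over the first
  \<open>n\<close> sites contains exactly one of them.\<close>

abbreviation words :: "nat \<Rightarrow> (nat \<Rightarrow> 'a) set" where
  "words n \<equiv> PiE {..<n} (\<lambda>_. UNIV)"

lemma finite_words: "finite (words n :: (nat \<Rightarrow> 'a::finite) set)"
  by (simp add: finite_PiE)

lemma words_agree_iff:
  assumes "\<sigma> \<in> words n"
  shows "agree_below n \<eta> \<sigma> \<longleftrightarrow> \<sigma> = restrict \<eta> {..<n}"
  using assms by (auto simp: agree_below_def PiE_def extensional_def fun_eq_iff)

lemma sum_words_agree:
  fixes h :: "(nat \<Rightarrow> 'a::finite) \<Rightarrow> real"
  shows "(\<Sum>\<sigma>\<in>words n. h \<sigma> * of_bool (agree_below n \<eta> \<sigma>)) = h (restrict \<eta> {..<n})"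
proof -
  have "(\<Sum>\<sigma>\<in>words n. h \<sigma> * of_bool (agree_below n \<eta> \<sigma>))
      = (\<Sum>\<sigma>\<in>words n. if \<sigma> = restrict \<eta> {..<n} then h \<sigma> else 0)"
    by (intro sum.cong refl) (simp add: words_agree_iff)
  also have "\<dots> = h (restrict \<eta> {..<n})"
    by (subst sum.delta) (auto simp: finite_words)
  finally show ?thesis .
qed

lemma local_fun_restrict: "local_fun n f \<Longrightarrow> f (restrict \<eta> {..<n}) = f \<eta>"
  by (erule local_funD) (simp add: agree_below_def)

lemma finite_range_local_fun:
  assumes "local_fun n (g :: (nat \<Rightarrow> 'a::finite) \<Rightarrow> real)"
  shows "finite (range g)"
proof -
  have "range g \<subseteq> g ` words n"
  proof clarify
    fix \<eta> :: "nat \<Rightarrow> 'a"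
    have "restrict \<eta> {..<n} \<in> words n" by simp
    then show "g \<eta> \<in> g ` words n"
      using local_fun_restrict[OF assms, of \<eta>] by (metis imageI)
  qed
  then show ?thesis using finite_words finite_surj by blast
qed

lemmas variation_nonneg = variation_nonneg_le(1)[OF finite_range_local_fun]
lemmas variation_le = variation_nonneg_le(2)[OF finite_range_local_fun]

lemma variation_eq_0:
  assumes "local_fun n g" "n \<le> k"
  shows "variation g k = 0"
proof -
  have *: "g \<sigma> = g \<sigma>'" if "\<forall>j. j \<noteq> k \<longrightarrow> \<sigma> j = \<sigma>' j" for \<sigma> \<sigma>'
    using assms that by (intro local_funD[OF assms(1)]) (auto simp: agree_below_def)
  have "(\<lambda>(\<sigma>, \<sigma>'). \<bar>g \<sigma> - g \<sigma>'\<bar>) ` {(\<sigma>, \<sigma>'). \<forall>j. j \<noteq> k \<longrightarrow> \<sigma> j = \<sigma>' j} = {0}"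
    by (force dest!: * simp: image_iff)
  then show ?thesis by (simp add: variation_def)
qed

lemma ell2_norm_variation:
  assumes "local_fun n g"
  shows "(ell2_norm (variation g))\<^sup>2 = (\<Sum>k<n. (variation g k)\<^sup>2)" and "0 \<le> ell2_norm (variation g)"
proof -
  have "(\<Sum>k. (variation g k)\<^sup>2) = (\<Sum>k<n. (variation g k)\<^sup>2)"
    by (rule suminf_finite) (auto simp: variation_eq_0[OF assms])
  then have "ell2_norm (variation g) = sqrt (\<Sum>k<n. (variation g k)\<^sup>2)"
    by (simp add: ell2_norm_def)
  then show "(ell2_norm (variation g))\<^sup>2 = (\<Sum>k<n. (variation g k)\<^sup>2)" and "0 \<le> ell2_norm (variation g)"
    by (simp_all add: sum_nonneg)
qed

lemma ell2_norm_variation_eq_0_iff: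
  assumes "local_fun n (g :: (nat \<Rightarrow> 'a::finite) \<Rightarrow> real)"
  shows "ell2_norm (variation g) = 0 \<longleftrightarrow> (\<forall>j. variation g j = 0)"
proof -
  have "ell2_norm (variation g) = 0 \<longleftrightarrow> (\<Sum>k<n. (variation g k)\<^sup>2) = 0"
    using ell2_norm_variation(1)[OF assms] by (metis power_zero_numeral power2_eq_square mult_eq_0_iff)
  also have "\<dots> \<longleftrightarrow> (\<forall>j<n. variation g j = 0)"
    by (subst sum_nonneg_eq_0_iff) auto
  finally show ?thesis using variation_eq_0[OF assms] by (metis leI)
qed

text \<open>Hybrid argument: pass from \<open>\<xi>\<close> to \<open>\<xi>'\<close> by changing one
  coordinate at a time; a step costs nothing where the two agree.\<close>

lemma variation_telescope:
  fixes g :: "(nat \<Rightarrow> 'a::finite) \<Rightarrow> real"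
  assumes g: "local_fun n g"
  shows "\<bar>g \<xi> - g \<xi>'\<bar> \<le> (\<Sum>k<n. variation g k * of_bool (\<xi> k \<noteq> \<xi>' k))"
proof -
  define z where "z k j = (if j < k then \<xi>' j else \<xi> j)" for k j
  have "g \<xi>' = g (z n)"
    by (rule local_funD[OF g]) (simp add: agree_below_def z_def)
  moreover have "z 0 = \<xi>" by (simp add: z_def fun_eq_iff)
  ultimately have "\<bar>g \<xi> - g \<xi>'\<bar> = \<bar>\<Sum>k<n. g (z k) - g (z (Suc k))\<bar>"
    by (simp add: sum_lessThan_telescope'[of "\<lambda>k. g (z k)" n])
  also have "\<dots> \<le> (\<Sum>k<n. variation g k * of_bool (\<xi> k \<noteq> \<xi>' k))"
  proof (intro order_trans[OF sum_abs] sum_mono)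
    fix k
    show "\<bar>g (z k) - g (z (Suc k))\<bar> \<le> variation g k * of_bool (\<xi> k \<noteq> \<xi>' k)"
    proof (cases "\<xi> k = \<xi>' k")
      case True
      then have "z k = z (Suc k)" by (auto simp: z_def fun_eq_iff less_Suc_eq)
      then show ?thesis by (simp add: variation_nonneg[OF g])
    next
      case False
      then show ?thesis by (auto intro!: variation_le[OF g] simp: z_def)
    qed
  qed
  finally show ?thesis .
qed

section \<open>The martingale of cylinder means\<close>

locale finite_config_prob = prob_space P for P :: "(nat \<Rightarrow> 'a::finite) measure" +
  assumes sets_P: "sets P = sets (coord_space UNIV)"
begin

definition cyl :: "nat \<Rightarrow> (nat \<Rightarrow> 'a) \<Rightarrow> (nat \<Rightarrow> 'a) set" where
  "cyl n \<sigma> = {\<eta>. agree_below n \<eta> \<sigma>}"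

text \<open>On a null cylinder the quotient is the junk value 0; such cylinders never carry weight below.\<close>

definition cyl_mean :: "((nat \<Rightarrow> 'a) \<Rightarrow> real) \<Rightarrow> nat \<Rightarrow> (nat \<Rightarrow> 'a) \<Rightarrow> real" where
  "cyl_mean g n \<sigma> = (\<integral>\<eta>. g \<eta> * indicator (cyl n \<sigma>) \<eta> \<partial>P) / prob (cyl n \<sigma>)"

lemma space_P: "space P = UNIV"
  using sets_eq_imp_space_eq[OF sets_P] by (simp add: coord_space_def space_PiM)

lemma measurable_coord: "(\<lambda>\<eta>. \<eta> j) \<in> measurable P (count_space UNIV)"
  using measurable_component_singleton[of j UNIV "\<lambda>_. count_space UNIV"]
  by (simp add: measurable_cong_sets[OF sets_P refl] coord_space_def)

lemma sets_cyl [measurable]: "cyl n \<sigma> \<in> sets P"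
proof -
  note measurable_coord [measurable]
  have "cyl n \<sigma> = {\<eta> \<in> space P. \<forall>j\<in>{..<n}. \<eta> j = \<sigma> j}"
    by (auto simp: cyl_def agree_below_def space_P)
  also have "\<dots> \<in> sets P" by measurable
  finally show ?thesis .
qed

lemma local_fun_expand:
  assumes "local_fun n f"
  shows "f \<eta> = (\<Sum>\<sigma>\<in>words n. f \<sigma> * indicator (cyl n \<sigma>) \<eta>)"
proof -
  have "(\<Sum>\<sigma>\<in>words n. f \<sigma> * indicator (cyl n \<sigma>) \<eta>) = (\<Sum>\<sigma>\<in>words n. f \<sigma> * of_bool (agree_below n \<eta> \<sigma>))"
    by (simp add: cyl_def indicator_def)
  then show ?thesis by (simp add: sum_words_agree local_fun_restrict[OF assms])
qed

lemma local_fun_measurable: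
  assumes "local_fun n f"
  shows "f \<in> borel_measurable P"
proof -
  have "(\<lambda>\<eta>. \<Sum>\<sigma>\<in>words n. f \<sigma> * indicator (cyl n \<sigma>) \<eta>) \<in> borel_measurable P" by measurable
  then show ?thesis by (simp flip: local_fun_expand[OF assms])
qed

lemma integrable_local_fun:
  assumes "local_fun n f"
  shows "integrable P f"
proof -
  have "integrable P (\<lambda>\<eta>. \<Sum>\<sigma>\<in>words n. f \<sigma> * indicator (cyl n \<sigma>) \<eta>)"
    by (intro Bochner_Integration.integrable_sum integrable_mult_right
        integrable_real_indicator) (auto simp: emeasure_eq_measure)
  then show ?thesis by (simp flip: local_fun_expand[OF assms])
qed

lemma integral_local_fun:
  assumes "local_fun n f"
  shows "(\<integral>\<eta>. f \<eta> \<partial>P) = (\<Sum>\<sigma>\<in>words n. prob (cyl n \<sigma>) * f \<sigma>)"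
proof -
  have "(\<integral>\<eta>. f \<eta> \<partial>P) = (\<integral>\<eta>. (\<Sum>\<sigma>\<in>words n. f \<sigma> * indicator (cyl n \<sigma>) \<eta>) \<partial>P)"
    by (simp flip: local_fun_expand[OF assms])
  also have "\<dots> = (\<Sum>\<sigma>\<in>words n. prob (cyl n \<sigma>) * f \<sigma>)"
    by (subst Bochner_Integration.integral_sum)
      (auto simp: mult.commute emeasure_eq_measure)
  finally show ?thesis .
qed

lemma indicator_cyl_Suc:
  "indicator (cyl i \<sigma>) \<eta> = (\<Sum>a\<in>UNIV. indicator (cyl (Suc i) (\<sigma>(i := a))) \<eta> :: real)"
proof -
  have "(\<Sum>a\<in>UNIV. indicator (cyl (Suc i) (\<sigma>(i := a))) \<eta> :: real)
      = (\<Sum>a\<in>UNIV. if a = \<eta> i then indicator (cyl i \<sigma>) \<eta> else 0)"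
    by (intro sum.cong refl) (auto simp: cyl_def indicator_def agree_below_Suc_upd)
  then show ?thesis by simp
qed

lemma prob_cyl_Suc: "prob (cyl i \<sigma>) = (\<Sum>a\<in>UNIV. prob (cyl (Suc i) (\<sigma>(i := a))))"
proof -
  have "prob (cyl i \<sigma>) = (\<integral>\<eta>. indicator (cyl i \<sigma>) \<eta> \<partial>P)" by simp
  also have "\<dots> = (\<integral>\<eta>. (\<Sum>a\<in>UNIV. indicator (cyl (Suc i) (\<sigma>(i := a))) \<eta>) \<partial>P)"
    by (simp only: indicator_cyl_Suc[of i \<sigma>])
  also have "\<dots> = (\<Sum>a\<in>UNIV. prob (cyl (Suc i) (\<sigma>(i := a))))"
    by (subst Bochner_Integration.integral_sum) (auto simp: emeasure_eq_measure)
  finally show ?thesis .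
qed

text \<open>Both sides vanish on a null cylinder, so in this product form the tower identity below
  needs no case distinction.\<close>

lemma cyl_mean_mult: "prob (cyl i \<sigma>) * cyl_mean g i \<sigma> = (\<integral>\<eta>. g \<eta> * indicator (cyl i \<sigma>) \<eta> \<partial>P)"
proof (cases "prob (cyl i \<sigma>) = 0")
  case True
  then have "cyl i \<sigma> \<in> null_sets P"
    by (intro null_setsI) (auto simp: emeasure_eq_measure)
  then have "AE \<eta> in P. \<eta> \<notin> cyl i \<sigma>" by (rule AE_not_in)
  then have "(\<integral>\<eta>. g \<eta> * indicator (cyl i \<sigma>) \<eta> \<partial>P) = 0"
    by (intro integral_eq_zero_AE) (auto simp: indicator_def)
  with True show ?thesis by simp
qed (simp add: cyl_mean_def)

text \<open>The martingale property of the cylinder means, weighted by masses: a cylinder splits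
  according to its next letter.\<close>

lemma cyl_mean_Suc:
  assumes "local_fun n g"
  shows "prob (cyl i \<sigma>) * cyl_mean g i \<sigma>
    = (\<Sum>a\<in>UNIV. prob (cyl (Suc i) (\<sigma>(i := a))) * cyl_mean g (Suc i) (\<sigma>(i := a)))"
proof -
  have int: "integrable P (\<lambda>\<eta>. g \<eta> * indicator (cyl j \<tau>) \<eta>)" for j \<tau>
    by (intro integrable_real_mult_indicator integrable_local_fun[OF assms]) simp
  have "(\<integral>\<eta>. g \<eta> * indicator (cyl i \<sigma>) \<eta> \<partial>P)
      = (\<integral>\<eta>. (\<Sum>a\<in>UNIV. g \<eta> * indicator (cyl (Suc i) (\<sigma>(i := a))) \<eta>) \<partial>P)"
    by (simp only: indicator_cyl_Suc[of i \<sigma>] sum_distrib_left)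
  also have "\<dots> = (\<Sum>a\<in>UNIV. \<integral>\<eta>. g \<eta> * indicator (cyl (Suc i) (\<sigma>(i := a))) \<eta> \<partial>P)"
    using int by (intro Bochner_Integration.integral_sum)
  finally show ?thesis by (simp add: cyl_mean_mult)
qed

lemma cyl_cong: "agree_below n \<sigma> \<sigma>' \<Longrightarrow> cyl n \<sigma> = cyl n \<sigma>'"
  by (auto simp: cyl_def agree_below_def)

lemma local_fun_cyl_mean: "local_fun n (cyl_mean g n)"
  by (auto simp: local_fun_def cyl_mean_def dest: cyl_cong)

lemma cyl_mean_0: "cyl_mean g 0 \<sigma> = (\<integral>\<eta>. g \<eta> \<partial>P)"
proof -
  have "cyl 0 \<sigma> = space P" by (auto simp: cyl_def agree_below_def space_P)
  then show ?thesis using prob_space by (simp add: cyl_mean_def space_P)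
qed

lemma cyl_mean_local_fun:
  assumes "local_fun n g" "0 < prob (cyl n \<sigma>)"
  shows "cyl_mean g n \<sigma> = g \<sigma>"
proof -
  have "g \<eta> * indicator (cyl n \<sigma>) \<eta> = g \<sigma> * indicator (cyl n \<sigma>) \<eta>" for \<eta>
    using local_funD[OF assms(1)] by (auto simp: cyl_def indicator_def)
  then have "(\<integral>\<eta>. g \<eta> * indicator (cyl n \<sigma>) \<eta> \<partial>P)
      = (\<integral>\<eta>. g \<sigma> * indicator (cyl n \<sigma>) \<eta> \<partial>P)"
    by (intro Bochner_Integration.integral_cong refl)
  then have "(\<integral>\<eta>. g \<eta> * indicator (cyl n \<sigma>) \<eta> \<partial>P) = g \<sigma> * prob (cyl n \<sigma>)" by simp
  with assms(2) show ?thesis by (simp add: cyl_mean_def)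
qed

text \<open>Words of length \<open>Suc i\<close> are enumerated as a word of length \<open>i\<close>
  plus a last letter, which exposes the siblings over which one martingale step averages.\<close>

lemma local_fun_expand_Suc:
  assumes "local_fun (Suc i) f"
  shows "f \<eta> = (\<Sum>\<sigma>\<in>words i. \<Sum>a\<in>UNIV. f (\<sigma>(i := a)) * indicator (cyl (Suc i) (\<sigma>(i := a))) \<eta>)"
proof -
  have f: "f (\<sigma>(i := a)) * indicator (cyl (Suc i) (\<sigma>(i := a))) \<eta>
      = f \<eta> * indicator (cyl (Suc i) (\<sigma>(i := a))) \<eta>" for \<sigma> a
    using local_funD[OF assms, of \<eta> "\<sigma>(i := a)"] by (auto simp: cyl_def indicator_def)
  have "(\<Sum>\<sigma>\<in>words i. \<Sum>a\<in>UNIV. f (\<sigma>(i := a)) * indicator (cyl (Suc i) (\<sigma>(i := a))) \<eta>)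
      = (\<Sum>\<sigma>\<in>words i. f \<eta> * indicator (cyl i \<sigma>) \<eta>)"
    by (simp only: f indicator_cyl_Suc[of i] sum_distrib_left)
  also have "\<dots> = (\<Sum>\<sigma>\<in>words i. (\<lambda>_. f \<eta>) \<sigma> * of_bool (agree_below i \<eta> \<sigma>))"
    by (simp add: cyl_def indicator_def)
  also have "\<dots> = f \<eta>" by (rule sum_words_agree)
  finally show ?thesis by simp
qed

lemma integral_local_fun_Suc:
  assumes "local_fun (Suc i) f"
  shows "(\<integral>\<eta>. f \<eta> \<partial>P) = (\<Sum>\<sigma>\<in>words i. \<Sum>a\<in>UNIV. prob (cyl (Suc i) (\<sigma>(i := a))) * f (\<sigma>(i := a)))"
proof -
  have int: "integrable P (\<lambda>\<eta>. c * indicator (cyl j \<tau>) \<eta>)" for c :: real and j \<tau>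
    by (intro integrable_mult_right integrable_real_indicator) (auto simp: emeasure_eq_measure)
  have "(\<integral>\<eta>. f \<eta> \<partial>P)
      = (\<integral>\<eta>. (\<Sum>\<sigma>\<in>words i. \<Sum>a\<in>UNIV. f (\<sigma>(i := a)) * indicator (cyl (Suc i) (\<sigma>(i := a))) \<eta>) \<partial>P)"
    by (rule Bochner_Integration.integral_cong[OF refl local_fun_expand_Suc[OF assms]])
  also have "\<dots> = (\<Sum>\<sigma>\<in>words i. \<Sum>a\<in>UNIV. \<integral>\<eta>. f (\<sigma>(i := a)) * indicator (cyl (Suc i) (\<sigma>(i := a))) \<eta> \<partial>P)"
    using int by (simp only: Bochner_Integration.integral_sum Bochner_Integration.integrable_sum)
  also have "\<dots> = (\<Sum>\<sigma>\<in>words i. \<Sum>a\<in>UNIV. prob (cyl (Suc i) (\<sigma>(i := a))) * f (\<sigma>(i := a)))"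
    by (simp add: mult.commute)
  finally show ?thesis .
qed

text \<open>\<open>X k\<close> behaves as a supermartingale: \<open>d k\<close> is determined by the
  first \<open>k\<close> coordinates, so exp (- l^2 (d k)^2) is constant over the children of a
  cylinder of length \<open>k\<close> and cancels the factor produced by
  \<open>weighted_exp_le\<close>.\<close>

lemma exp_martingale:
  fixes d :: "nat \<Rightarrow> (nat \<Rightarrow> 'a) \<Rightarrow> real"
  assumes g: "local_fun n g" and d: "\<And>i. local_fun i (d i)"
    and osc: "\<And>i \<sigma> a b. 0 < prob (cyl (Suc i) (\<sigma>(i := a))) \<Longrightarrow> 0 < prob (cyl (Suc i) (\<sigma>(i := b))) \<Longrightarrow>
      \<bar>cyl_mean g (Suc i) (\<sigma>(i := a)) - cyl_mean g (Suc i) (\<sigma>(i := b))\<bar> \<le> d i \<sigma>"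
  shows "(\<integral>\<eta>. exp (l * (g \<eta> - expectation g) - l\<^sup>2 * (\<Sum>i<n. (d i \<eta>)\<^sup>2)) \<partial>P) \<le> 1"
proof -
  define X where "X k \<eta> = exp (l * (cyl_mean g k \<eta> - expectation g) - l\<^sup>2 * (\<Sum>i<k. (d i \<eta>)\<^sup>2))" for k \<eta>
  have d_cong: "d i \<eta> = d i \<eta>'" if "agree_below k \<eta> \<eta>'" "i \<le> k" for i k \<eta> \<eta>'
    using that local_fun_mono[OF d] local_funD by blast
  have sq_cong: "(\<Sum>i<k. (d i \<eta>)\<^sup>2) = (\<Sum>i<k. (d i \<eta>')\<^sup>2)" if "agree_below k \<eta> \<eta>'" for k \<eta> \<eta>'
    by (intro sum.cong refl arg_cong[where f = "\<lambda>x. x\<^sup>2"] d_cong[OF that]) auto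
  have X_local: "local_fun k (X k)" for k
    unfolding local_fun_def
  proof (intro allI impI)
    fix \<sigma> \<sigma>' :: "nat \<Rightarrow> 'a" assume *: "agree_below k \<sigma> \<sigma>'"
    show "X k \<sigma> = X k \<sigma>'"
      unfolding X_def using local_funD[OF local_fun_cyl_mean *] sq_cong[OF *] by simp
  qed
  have "expectation (X k) \<le> 1" for k
  proof (induction k)
    case 0
    have "X 0 = (\<lambda>_. 1)" by (simp add: X_def cyl_mean_0 fun_eq_iff)
    then show ?case by (simp add: prob_space)
  next
    case (Suc k)
    have "expectation (X (Suc k)) = (\<Sum>\<sigma>\<in>words k. \<Sum>a\<in>UNIV. prob (cyl (Suc k) (\<sigma>(k := a))) * X (Suc k) (\<sigma>(k := a)))"
      by (rule integral_local_fun_Suc[OF X_local])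
    also have "\<dots> \<le> (\<Sum>\<sigma>\<in>words k. prob (cyl k \<sigma>) * X k \<sigma>)"
    proof (rule sum_mono)
      fix \<sigma> :: "nat \<Rightarrow> 'a"
      let ?p = "\<lambda>a. prob (cyl (Suc k) (\<sigma>(k := a)))" and ?x = "\<lambda>a. cyl_mean g (Suc k) (\<sigma>(k := a))"
      let ?m = "cyl_mean g k \<sigma>"
      have "X (Suc k) (\<sigma>(k := a)) = X k \<sigma> * exp (- (l\<^sup>2 * (d k \<sigma>)\<^sup>2)) * exp (l * (?x a - ?m))" for a
      proof -
        have "agree_below k (\<sigma>(k := a)) \<sigma>" by (simp add: agree_below_def)
        then have "(\<Sum>i<Suc k. (d i (\<sigma>(k := a)))\<^sup>2) = (\<Sum>i<Suc k. (d i \<sigma>)\<^sup>2)"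
          by (intro sum.cong refl arg_cong[where f = "\<lambda>x. x\<^sup>2"] d_cong) auto
        then show ?thesis
          unfolding X_def exp_add[symmetric] by (simp add: algebra_simps)
      qed
      then have "(\<Sum>a\<in>UNIV. ?p a * X (Suc k) (\<sigma>(k := a)))
          = X k \<sigma> * exp (- (l\<^sup>2 * (d k \<sigma>)\<^sup>2)) * (\<Sum>a\<in>UNIV. ?p a * exp (l * (?x a - ?m)))"
        by (simp add: sum_distrib_left mult_ac)
      also have "\<dots> \<le> X k \<sigma> * exp (- (l\<^sup>2 * (d k \<sigma>)\<^sup>2)) * ((\<Sum>a\<in>UNIV. ?p a) * exp (l\<^sup>2 * (d k \<sigma>)\<^sup>2))"
        using cyl_mean_Suc[OF g, of k \<sigma>] osc
        by (intro mult_left_mono weighted_exp_le) (auto simp: X_def simp flip: prob_cyl_Suc)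
      also have "\<dots> = prob (cyl k \<sigma>) * X k \<sigma>"
        by (simp add: exp_minus field_simps flip: prob_cyl_Suc)
      finally show "(\<Sum>a\<in>UNIV. ?p a * X (Suc k) (\<sigma>(k := a))) \<le> prob (cyl k \<sigma>) * X k \<sigma>" .
    qed
    also have "\<dots> = expectation (X k)" by (rule integral_local_fun[OF X_local, symmetric])
    finally show ?case using Suc.IH by linarith
  qed
  \<comment> \<open>On a null cylinder \<open>cyl_mean g n\<close> need not equal \<open>g\<close>.
    The two exponentials are therefore compared after integration, where such cylinders have weight
    0.\<close>
  moreover have "(\<integral>\<eta>. exp (l * (g \<eta> - expectation g) - l\<^sup>2 * (\<Sum>i<n. (d i \<eta>)\<^sup>2)) \<partial>P) = expectation (X n)"
  proof -
    have loc: "local_fun n (\<lambda>\<eta>. exp (l * (g \<eta> - expectation g) - l\<^sup>2 * (\<Sum>i<n. (d i \<eta>)\<^sup>2)))"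
      unfolding local_fun_def
    proof (intro allI impI)
      fix \<sigma> \<sigma>' :: "nat \<Rightarrow> 'a" assume *: "agree_below n \<sigma> \<sigma>'"
      show "exp (l * (g \<sigma> - expectation g) - l\<^sup>2 * (\<Sum>i<n. (d i \<sigma>)\<^sup>2))
          = exp (l * (g \<sigma>' - expectation g) - l\<^sup>2 * (\<Sum>i<n. (d i \<sigma>')\<^sup>2))"
        using local_funD[OF g *] sq_cong[OF *] by simp
    qed
    show ?thesis
      unfolding integral_local_fun[OF X_local[of n]] integral_local_fun[OF loc]
    proof (intro sum.cong refl)
      fix \<sigma> :: "nat \<Rightarrow> 'a"
      show "prob (cyl n \<sigma>) * exp (l * (g \<sigma> - expectation g) - l\<^sup>2 * (\<Sum>i<n. (d i \<sigma>)\<^sup>2))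
          = prob (cyl n \<sigma>) * X n \<sigma>"
        using cyl_mean_local_fun[OF g, of \<sigma>]
        by (cases "prob (cyl n \<sigma>) = 0") (simp_all add: X_def zero_less_measure_iff)
    qed
  qed
  ultimately show ?thesis by simp
qed

lemma martingale_tail:
  fixes d :: "nat \<Rightarrow> (nat \<Rightarrow> 'a) \<Rightarrow> real"
  assumes g: "local_fun n g" and d: "\<And>i. local_fun i (d i)"
    and osc: "\<And>i \<sigma> a b. 0 < prob (cyl (Suc i) (\<sigma>(i := a))) \<Longrightarrow> 0 < prob (cyl (Suc i) (\<sigma>(i := b))) \<Longrightarrow>
      \<bar>cyl_mean g (Suc i) (\<sigma>(i := a)) - cyl_mean g (Suc i) (\<sigma>(i := b))\<bar> \<le> d i \<sigma>"
    and t: "0 < t" and v: "0 < v"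
  shows "\<P>(\<eta> in P. \<bar>g \<eta> - expectation g\<bar> > t \<and> (\<Sum>i<n. (d i \<eta>)\<^sup>2) \<le> v) \<le> 2 * exp (- t\<^sup>2 / (4 * v))"
proof -
  let ?B = "\<lambda>\<eta>. \<Sum>i<n. (d i \<eta>)\<^sup>2" and ?S = "\<lambda>\<eta>. g \<eta> - expectation g"
  have B_local: "local_fun n ?B"
    unfolding local_fun_def
  proof (intro allI impI sum.cong refl)
    fix \<sigma> \<sigma>' :: "nat \<Rightarrow> 'a" and i assume "agree_below n \<sigma> \<sigma>'" "i \<in> {..<n}"
    then show "(d i \<sigma>)\<^sup>2 = (d i \<sigma>')\<^sup>2"
      using local_funD[OF local_fun_mono[OF d[of i], of n]] by simp
  qed
  have meas [measurable]: "?B \<in> borel_measurable P" "g \<in> borel_measurable P"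
    using local_fun_measurable[OF B_local] local_fun_measurable[OF g] by auto
  have one_side: "\<P>(\<eta> in P. e * ?S \<eta> > t \<and> ?B \<eta> \<le> v) \<le> exp (- t\<^sup>2 / (4 * v))"
    if e: "e = 1 \<or> e = -1" for e :: real
  proof -
    \<comment> \<open>The value t / (2 v) maximises l t - l^2 v, with maximum t^2 / (4 v); the sign
      \<open>e\<close> selects the upper or the lower tail.\<close>
    define l where "l = e * (t / (2 * v))"
    define Y where "Y \<eta> = exp (l * ?S \<eta> - l\<^sup>2 * ?B \<eta>)" for \<eta>
    have Y_pos: "0 < Y \<eta>" for \<eta> by (simp add: Y_def)
    have l2: "l\<^sup>2 = (t / (2 * v))\<^sup>2" using e by (auto simp: l_def)
    have Y_local: "local_fun n Y"
      unfolding local_fun_def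
    proof (intro allI impI)
      fix \<sigma> \<sigma>' :: "nat \<Rightarrow> 'a" assume *: "agree_below n \<sigma> \<sigma>'"
      show "Y \<sigma> = Y \<sigma>'"
        using local_funD[OF g *] local_funD[OF B_local *] by (simp add: Y_def)
    qed
    have "{\<eta> \<in> space P. e * ?S \<eta> > t \<and> ?B \<eta> \<le> v} \<subseteq> {\<eta> \<in> space P. Y \<eta> \<ge> exp (t\<^sup>2 / (4 * v))}"
    proof clarify
      fix \<eta> assume h: "t < e * ?S \<eta>" "?B \<eta> \<le> v"
      have "t\<^sup>2 / (4 * v) = t / (2 * v) * t - l\<^sup>2 * v"
        unfolding l2 using v by (simp add: field_simps power2_eq_square)
      also have "\<dots> \<le> t / (2 * v) * (e * ?S \<eta>) - l\<^sup>2 * ?B \<eta>"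
        using h v t by (intro diff_mono mult_left_mono) auto
      also have "\<dots> = l * ?S \<eta> - l\<^sup>2 * ?B \<eta>" by (simp add: l_def)
      finally show "Y \<eta> \<ge> exp (t\<^sup>2 / (4 * v))" by (simp add: Y_def)
    qed
    then have "\<P>(\<eta> in P. e * ?S \<eta> > t \<and> ?B \<eta> \<le> v) \<le> \<P>(\<eta> in P. Y \<eta> \<ge> exp (t\<^sup>2 / (4 * v)))"
      using local_fun_measurable[OF Y_local] by (intro finite_measure_mono) auto
    also have "\<dots> \<le> expectation Y / exp (t\<^sup>2 / (4 * v))"
      by (rule integral_Markov_inequality_measure[where A = "{}"])
        (use integrable_local_fun[OF Y_local] in \<open>auto simp: Y_pos less_imp_le\<close>)
    also have "\<dots> \<le> 1 / exp (t\<^sup>2 / (4 * v))"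
      using exp_martingale[OF g d osc] unfolding Y_def by (intro divide_right_mono) auto
    finally show ?thesis by (simp add: exp_minus field_simps)
  qed
  have "\<P>(\<eta> in P. \<bar>?S \<eta>\<bar> > t \<and> ?B \<eta> \<le> v)
      \<le> prob ({\<eta> \<in> space P. 1 * ?S \<eta> > t \<and> ?B \<eta> \<le> v} \<union> {\<eta> \<in> space P. -1 * ?S \<eta> > t \<and> ?B \<eta> \<le> v})"
    by (intro finite_measure_mono) (auto simp: abs_if split: if_splits)
  also have "\<dots> \<le> \<P>(\<eta> in P. 1 * ?S \<eta> > t \<and> ?B \<eta> \<le> v) + \<P>(\<eta> in P. -1 * ?S \<eta> > t \<and> ?B \<eta> \<le> v)"
    by (intro measure_Un_le) auto
  also have "\<dots> \<le> exp (- t\<^sup>2 / (4 * v)) + exp (- t\<^sup>2 / (4 * v))"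
    by (intro add_mono one_side) auto
  finally show ?thesis by simp
qed

end

section \<open>Increments and couplings\<close>

text \<open>Reduces integrals of finitely valued functions to measures of level sets, the form in
  which \<open>conditional_versions\<close> ties a kernel to P.\<close>

lemma (in finite_measure) integral_finite_range_indicator:
  fixes f :: "'a \<Rightarrow> real"
  assumes "f \<in> borel_measurable M" "finite F" "f ` space M \<subseteq> F" "A \<in> sets M"
  shows "(\<integral>x. f x * indicator A x \<partial>M) = (\<Sum>y\<in>F. y * measure M ({x \<in> space M. f x = y} \<inter> A))"
proof -
  have sets: "{x \<in> space M. f x = y} \<inter> A \<in> sets M" for y
    using assms by measurable
  have "(\<integral>x. f x * indicator A x \<partial>M) = (\<integral>x. (\<Sum>y\<in>F. y * indicator ({x \<in> space M. f x = y} \<inter> A) x) \<partial>M)"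
  proof (rule Bochner_Integration.integral_cong[OF refl])
    fix x assume x: "x \<in> space M"
    have "(\<Sum>y\<in>F. y * indicator ({x \<in> space M. f x = y} \<inter> A) x)
        = (\<Sum>y\<in>F. if y = f x then f x * indicator A x else 0)"
      using x by (intro sum.cong) (auto simp: indicator_def)
    also have "\<dots> = f x * indicator A x"
      using assms x by (subst sum.delta) auto
    finally show "f x * indicator A x = (\<Sum>y\<in>F. y * indicator ({x \<in> space M. f x = y} \<inter> A) x)" by simp
  qed
  also have "\<dots> = (\<Sum>y\<in>F. \<integral>x. y * indicator ({x \<in> space M. f x = y} \<inter> A) x \<partial>M)"
    using sets by (intro Bochner_Integration.integral_sum integrable_mult_right integrable_real_indicator)
      (auto simp: emeasure_eq_measure)
  also have "\<dots> = (\<Sum>y\<in>F. y * measure M ({x \<in> space M. f x = y} \<inter> A))"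
    using sets by (intro sum.cong refl) (simp add: sets.sets_into_space Int_absorb2)
  finally show ?thesis .
qed

text \<open>The kernel \<open>K i \<tau>\<close> lives on the coordinates from \<open>i\<close> on;
  the past is filled in from \<open>\<tau>\<close> so that a function of full configurations can be
  evaluated.\<close>

definition splice_at :: "nat \<Rightarrow> (nat \<Rightarrow> 'a) \<Rightarrow> (nat \<Rightarrow> 'a) \<Rightarrow> nat \<Rightarrow> 'a" where
  "splice_at i \<tau> \<eta> j = (if j < i then \<tau> j else \<eta> j)"

lemma splice_at_restrict: "agree_below i \<eta> \<tau> \<Longrightarrow> splice_at i \<tau> (restrict \<eta> {i..}) = \<eta>"
  by (auto simp: splice_at_def agree_below_def fun_eq_iff)

lemma local_fun_splice_measurable:
  fixes g :: "(nat \<Rightarrow> 'a::finite) \<Rightarrow> real"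
  assumes g: "local_fun n g"
  shows "(\<lambda>\<eta>. g (splice_at i \<tau> \<eta>)) \<in> borel_measurable (coord_space {i..})"
proof -
  have coord [measurable]:
    "(\<lambda>\<eta>. splice_at i \<tau> \<eta> j) \<in> measurable (coord_space {i..}) (count_space UNIV)" for j
    by (cases "j < i") (auto simp: splice_at_def coord_space_def intro!: measurable_component_singleton)
  have "(\<lambda>\<eta>. \<Sum>\<sigma>\<in>words n. g \<sigma> * of_bool (\<forall>j\<in>{..<n}. splice_at i \<tau> \<eta> j = \<sigma> j))
      \<in> borel_measurable (coord_space {i..})"
    by measurable
  moreover have "(\<Sum>\<sigma>\<in>words n. g \<sigma> * of_bool (\<forall>j\<in>{..<n}. splice_at i \<tau> \<eta> j = \<sigma> j)) = g (splice_at i \<tau> \<eta>)" for \<eta>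
    using sum_words_agree[of g n "splice_at i \<tau> \<eta>"] local_fun_restrict[OF g]
    by (simp add: agree_below_def Ball_def)
  ultimately show ?thesis by simp
qed

lemma coupling_matrix_nonneg: "0 \<le> coupling_matrix Q \<sigma> i k"
proof -
  let ?f = "\<lambda>(a, b). \<P>(\<omega> in Q i \<sigma> a b. fst \<omega> k \<noteq> snd \<omega> k)"
  have "0 \<le> ?f (undefined, undefined)" by simp
  also have "\<dots> \<le> Max (range ?f)" by (intro Max_ge) auto
  finally have "0 \<le> Max (range ?f)" .
  then show ?thesis by (simp add: coupling_matrix_def)
qed

lemma prob_neq_le_coupling_matrix:
  "i < k \<Longrightarrow> \<P>(\<omega> in Q i \<sigma> a b. fst \<omega> k \<noteq> snd \<omega> k) \<le> coupling_matrix Q \<sigma> i k"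
proof -
  let ?f = "\<lambda>(a, b). \<P>(\<omega> in Q i \<sigma> a b. fst \<omega> k \<noteq> snd \<omega> k)"
  have "?f (a, b) \<le> Max (range ?f)" by (intro Max_ge) auto
  then show "i < k \<Longrightarrow> ?thesis" by (simp add: coupling_matrix_def)
qed

text \<open>This is the predictability of the rows of the matrix, on which the use of
  \<open>martingale_tail\<close> rests.\<close>

lemma coupling_matrix_cong:
  assumes "maximal_coupling_family K Q" "agree_below i \<sigma> \<sigma>'"
  shows "coupling_matrix Q \<sigma> i k = coupling_matrix Q \<sigma>' i k"
proof -
  have "Q i \<sigma> = Q i \<sigma>'"
    using assms by (auto simp: maximal_coupling_family_def fun_eq_iff)
  then show ?thesis by (simp add: coupling_matrix_def)
qed

section \<open>Oscillation of the cylinder means under a change of one letter\<close>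

context finite_config_prob
begin

text \<open>\<open>g\<close> takes finitely many values, so it suffices to match level sets; on the
  cylinder, restricting to the future and splicing the past back in is the identity.\<close>

lemma integral_kernel_eq_cyl_mean:
  assumes K: "conditional_versions P K" and pos: "0 < prob (cyl i \<tau>)" and g: "local_fun n g"
  shows "(\<integral>\<eta>. g (splice_at i \<tau> \<eta>) \<partial>K i \<tau>) = cyl_mean g i \<tau>"
proof -
  let ?h = "\<lambda>\<eta>. g (splice_at i \<tau> \<eta>)"
  have prob_K: "prob_space (K i \<tau>)" and sets_K: "sets (K i \<tau>) = sets (coord_space {i..})"
    using K by (auto simp: conditional_versions_def)
  interpret K: prob_space "K i \<tau>" by (rule prob_K)
  have space_K: "space (K i \<tau>) = space (coord_space {i..})" by (rule sets_eq_imp_space_eq[OF sets_K])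
  have h: "?h \<in> borel_measurable (K i \<tau>)"
    using local_fun_splice_measurable[OF g] by (simp add: measurable_cong_sets[OF sets_K refl])
  have fin: "finite (range g)" by (rule finite_range_local_fun[OF g])
  have cyl: "{\<eta> \<in> space P. agree_below i \<eta> \<tau>} = cyl i \<tau>" by (simp add: cyl_def space_P)
  have K_level: "K.prob {\<eta> \<in> space (K i \<tau>). ?h \<eta> = y} = prob ({\<eta> \<in> space P. g \<eta> = y} \<inter> cyl i \<tau>) / prob (cyl i \<tau>)" for y
  proof -
    let ?B = "{\<eta> \<in> space (K i \<tau>). ?h \<eta> = y}"
    have "?B \<in> sets (coord_space {i..})"
      using h unfolding sets_K[symmetric] by measurable
    moreover have "\<forall>B\<in>sets (coord_space {i..}).
        K.prob B = \<P>(\<eta> in P. restrict \<eta> {i..} \<in> B \<bar> agree_below i \<eta> \<tau>)"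
      using K pos unfolding conditional_versions_def cyl[symmetric] by blast
    ultimately have "K.prob ?B = \<P>(\<eta> in P. restrict \<eta> {i..} \<in> ?B \<bar> agree_below i \<eta> \<tau>)"
      by (rule bspec[rotated])
    moreover have "{\<eta> \<in> space P. restrict \<eta> {i..} \<in> ?B \<and> agree_below i \<eta> \<tau>} = {\<eta> \<in> space P. g \<eta> = y} \<inter> cyl i \<tau>"
      by (auto simp: space_P cyl_def splice_at_restrict space_K coord_space_def space_PiM)
    ultimately show ?thesis by (simp add: cond_prob_def cyl)
  qed
  have "(\<integral>\<eta>. ?h \<eta> \<partial>K i \<tau>) = (\<integral>\<eta>. ?h \<eta> * indicator (space (K i \<tau>)) \<eta> \<partial>K i \<tau>)"
    by (intro Bochner_Integration.integral_cong) auto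
  also have "\<dots> = (\<Sum>y\<in>range g. y * K.prob ({\<eta> \<in> space (K i \<tau>). ?h \<eta> = y} \<inter> space (K i \<tau>)))"
    by (intro K.integral_finite_range_indicator h fin) auto
  also have "\<dots> = (\<Sum>y\<in>range g. y * K.prob {\<eta> \<in> space (K i \<tau>). ?h \<eta> = y})"
    by (intro sum.cong refl arg_cong2[where f = "(*)"] arg_cong[where f = K.prob]) auto
  also have "\<dots> = (\<Sum>y\<in>range g. y * prob ({\<eta> \<in> space P. g \<eta> = y} \<inter> cyl i \<tau>)) / prob (cyl i \<tau>)"
    by (simp add: K_level sum_divide_distrib)
  also have "(\<Sum>y\<in>range g. y * prob ({\<eta> \<in> space P. g \<eta> = y} \<inter> cyl i \<tau>)) = (\<integral>\<eta>. g \<eta> * indicator (cyl i \<tau>) \<eta> \<partial>P)"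
    by (intro integral_finite_range_indicator[symmetric] local_fun_measurable[OF g] fin) auto
  finally show ?thesis by (simp add: cyl_mean_def)
qed

text \<open>Both means become integrals over one coupling of the two futures. Their difference is
  telescoped over the coordinates, each weighted by its probability of disagreement.\<close>

lemma cyl_mean_osc:
  assumes K: "conditional_versions P K" and Q: "maximal_coupling_family K Q" and g: "local_fun n g"
    and pos: "0 < prob (cyl (Suc i) (\<sigma>(i := a)))" "0 < prob (cyl (Suc i) (\<sigma>(i := b)))"
  shows "\<bar>cyl_mean g (Suc i) (\<sigma>(i := a)) - cyl_mean g (Suc i) (\<sigma>(i := b))\<bar>
    \<le> (\<Sum>k<n. coupling_matrix Q \<sigma> i k * variation g k)"
proof -
  let ?C = "coord_space {Suc i..} :: (nat \<Rightarrow> 'a) measure"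
  define \<mu> where "\<mu> = K (Suc i) (\<sigma>(i := a))"
  define \<nu> where "\<nu> = K (Suc i) (\<sigma>(i := b))"
  define \<gamma> where "\<gamma> = Q i \<sigma> a b"
  have sets_\<mu>: "sets \<mu> = sets ?C" and sets_\<nu>: "sets \<nu> = sets ?C" and prob_\<mu>: "prob_space \<mu>"
    using K by (auto simp: conditional_versions_def \<mu>_def \<nu>_def)
  have "is_coupling \<mu> \<nu> \<gamma>"
    using Q by (auto simp: maximal_coupling_family_def is_maximal_coupling_def \<mu>_def \<nu>_def \<gamma>_def)
  then have sets_\<gamma>0: "sets \<gamma> = sets (\<mu> \<Otimes>\<^sub>M \<nu>)" and fst: "distr \<gamma> \<mu> fst = \<mu>" and snd: "distr \<gamma> \<nu> snd = \<nu>"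
    by (auto simp: is_coupling_def)
  have sets_\<gamma>: "sets \<gamma> = sets (?C \<Otimes>\<^sub>M ?C)"
    unfolding sets_\<gamma>0 by (rule sets_pair_measure_cong[OF sets_\<mu> sets_\<nu>])
  have fst_meas: "fst \<in> measurable \<gamma> \<mu>" and snd_meas: "snd \<in> measurable \<gamma> \<nu>"
    by (auto simp: measurable_cong_sets[OF sets_\<gamma>0 refl])
  \<comment> \<open>The total mass of the coupling is read off from its first marginal.\<close>
  interpret \<gamma>: prob_space \<gamma>
    using prob_\<mu> prob_space_distrD[OF fst_meas] by (simp add: fst)
  let ?x = "\<lambda>\<omega>. splice_at (Suc i) (\<sigma>(i := a)) (fst \<omega>)"
  let ?y = "\<lambda>\<omega>. splice_at (Suc i) (\<sigma>(i := b)) (snd \<omega>)"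
  have hx: "(\<lambda>\<eta>. g (splice_at (Suc i) \<tau> \<eta>)) \<in> borel_measurable \<mu>"
    and hy: "(\<lambda>\<eta>. g (splice_at (Suc i) \<tau> \<eta>)) \<in> borel_measurable \<nu>" for \<tau>
    using local_fun_splice_measurable[OF g]
    by (simp_all add: measurable_cong_sets[OF sets_\<mu> refl] measurable_cong_sets[OF sets_\<nu> refl])
  obtain B where B: "\<And>x. \<bar>g x\<bar> \<le> B"
    using finite_imp_bounded[OF finite_range_local_fun[OF g]] by (auto simp: bounded_real)
  have int_x: "integrable \<gamma> (\<lambda>\<omega>. g (?x \<omega>))" and int_y: "integrable \<gamma> (\<lambda>\<omega>. g (?y \<omega>))"
    using B measurable_compose[OF fst_meas hx] measurable_compose[OF snd_meas hy]
    by (auto intro!: \<gamma>.integrable_const_bound[where B = B])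
  have mean_x: "cyl_mean g (Suc i) (\<sigma>(i := a)) = (\<integral>\<omega>. g (?x \<omega>) \<partial>\<gamma>)"
  proof -
    have "cyl_mean g (Suc i) (\<sigma>(i := a)) = (\<integral>\<eta>. g (splice_at (Suc i) (\<sigma>(i := a)) \<eta>) \<partial>distr \<gamma> \<mu> fst)"
      unfolding fst unfolding \<mu>_def by (rule integral_kernel_eq_cyl_mean[OF K pos(1) g, symmetric])
    then show ?thesis using integral_distr[OF fst_meas hx] by simp
  qed
  have mean_y: "cyl_mean g (Suc i) (\<sigma>(i := b)) = (\<integral>\<omega>. g (?y \<omega>) \<partial>\<gamma>)"
  proof -
    have "cyl_mean g (Suc i) (\<sigma>(i := b)) = (\<integral>\<eta>. g (splice_at (Suc i) (\<sigma>(i := b)) \<eta>) \<partial>distr \<gamma> \<nu> snd)"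
      unfolding snd unfolding \<nu>_def by (rule integral_kernel_eq_cyl_mean[OF K pos(2) g, symmetric])
    then show ?thesis using integral_distr[OF snd_meas hy] by simp
  qed
  \<comment> \<open>Three regimes for a disagreement at \<open>k\<close>: before \<open>i\<close>
    both copies share the past of \<open>\<sigma>\<close>; at \<open>i\<close> they carry
    \<open>a\<close> and \<open>b\<close>, covered by the diagonal entry 1; after \<open>i\<close>
    the coupling decides.\<close>
  define e where "e k \<omega> = (of_bool (?x \<omega> k \<noteq> ?y \<omega> k) :: real)" for k \<omega>
  have e: "integrable \<gamma> (e k)" "(\<integral>\<omega>. e k \<omega> \<partial>\<gamma>) \<le> coupling_matrix Q \<sigma> i k" for k
  proof -
    have "integrable \<gamma> (e k) \<and> (\<integral>\<omega>. e k \<omega> \<partial>\<gamma>) \<le> coupling_matrix Q \<sigma> i k"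
    proof (cases k i rule: linorder_cases)
      case less
      then have "e k = (\<lambda>_. 0)" by (auto simp: e_def splice_at_def fun_eq_iff)
      then show ?thesis by (simp add: coupling_matrix_nonneg)
    next
      case equal
      then have "e k = (\<lambda>_. of_bool (a \<noteq> b))" by (auto simp: e_def splice_at_def fun_eq_iff)
      then show ?thesis using equal by (simp add: coupling_matrix_def \<gamma>.prob_space)
    next
      case greater
      let ?D = "{\<omega> \<in> space \<gamma>. fst \<omega> k \<noteq> snd \<omega> k}"
      have "{\<omega> \<in> space (?C \<Otimes>\<^sub>M ?C). fst \<omega> k \<noteq> snd \<omega> k} \<in> sets (?C \<Otimes>\<^sub>M ?C)"
      proof -
        have coord: "(\<lambda>\<eta>. \<eta> k) \<in> measurable ?C (count_space UNIV)"
          unfolding coord_space_def using greater by (intro measurable_component_singleton) simp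
        note measurable_compose[OF measurable_fst coord, measurable]
          measurable_compose[OF measurable_snd coord, measurable]
        show ?thesis by measurable
      qed
      then have D: "?D \<in> sets \<gamma>" by (simp add: sets_\<gamma> sets_eq_imp_space_eq[OF sets_\<gamma>])
      have eD: "e k \<omega> = indicator ?D \<omega>" if "\<omega> \<in> space \<gamma>" for \<omega>
        using greater that by (auto simp: e_def splice_at_def indicator_def)
      have "integrable \<gamma> (indicator ?D :: _ \<Rightarrow> real)"
        using D by (simp add: \<gamma>.emeasure_eq_measure)
      moreover have "integrable \<gamma> (e k) \<longleftrightarrow> integrable \<gamma> (indicator ?D :: _ \<Rightarrow> real)"
        by (rule Bochner_Integration.integrable_cong[OF refl eD])
      ultimately have "integrable \<gamma> (e k)" by simp
      moreover have "(\<integral>\<omega>. e k \<omega> \<partial>\<gamma>) = (\<integral>\<omega>. indicator ?D \<omega> \<partial>\<gamma>)"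
        by (rule Bochner_Integration.integral_cong[OF refl eD])
      moreover have "(\<integral>\<omega>. indicator ?D \<omega> \<partial>\<gamma>) = \<gamma>.prob ?D"
        using D by simp
      ultimately show ?thesis
        using prob_neq_le_coupling_matrix[OF greater, of Q \<sigma> a b] by (simp add: \<gamma>_def)
    qed
    then show "integrable \<gamma> (e k)" "(\<integral>\<omega>. e k \<omega> \<partial>\<gamma>) \<le> coupling_matrix Q \<sigma> i k" by auto
  qed
  have "\<bar>cyl_mean g (Suc i) (\<sigma>(i := a)) - cyl_mean g (Suc i) (\<sigma>(i := b))\<bar>
      = \<bar>\<integral>\<omega>. g (?x \<omega>) - g (?y \<omega>) \<partial>\<gamma>\<bar>"
    using int_x int_y by (simp add: mean_x mean_y)
  also have "\<dots> \<le> (\<integral>\<omega>. \<bar>g (?x \<omega>) - g (?y \<omega>)\<bar> \<partial>\<gamma>)" by (rule integral_abs_bound)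
  also have "\<dots> \<le> (\<integral>\<omega>. (\<Sum>k<n. variation g k * e k \<omega>) \<partial>\<gamma>)"
  proof (rule integral_mono)
    show "\<bar>g (?x \<omega>) - g (?y \<omega>)\<bar> \<le> (\<Sum>k<n. variation g k * e k \<omega>)" for \<omega>
      unfolding e_def by (rule variation_telescope[OF g])
  qed (use int_x int_y e(1) in auto)
  also have "\<dots> = (\<Sum>k<n. variation g k * (\<integral>\<omega>. e k \<omega> \<partial>\<gamma>))"
    using e(1) by (simp add: Bochner_Integration.integral_sum)
  also have "\<dots> \<le> (\<Sum>k<n. coupling_matrix Q \<sigma> i k * variation g k)"
    using e(2) variation_nonneg[OF g]
    by (intro sum_mono) (simp add: mult.commute mult_left_mono)
  finally show ?thesis .
qed

end

section \<open>Tails of the quadratic variation\<close>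

text \<open>The substitution k = i + j turns a sum along the rows of an upper triangular matrix into
  a sum along its columns.\<close>

lemma sum_triangle_swap:
  fixes f :: "nat \<Rightarrow> nat \<Rightarrow> real"
  shows "(\<Sum>i<n. \<Sum>j<n - i. f i j) = (\<Sum>k<n. \<Sum>j\<le>k. f (k - j) j)"
proof -
  have "(\<Sum>i<n. \<Sum>j<n - i. f i j) = (\<Sum>(i, j)\<in>(SIGMA i:{..<n}. {..<n - i}). f i j)"
    by (simp add: sum.Sigma)
  also have "\<dots> = (\<Sum>(k, j)\<in>(SIGMA k:{..<n}. {..k}). f (k - j) j)"
    by (rule sum.reindex_bij_witness[of _ "\<lambda>(k, j). (k - j, j)" "\<lambda>(i, j). (i + j, j)"]) auto
  also have "\<dots> = (\<Sum>k<n. \<Sum>j\<le>k. f (k - j) j)"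
    by (simp add: sum.Sigma)
  finally show ?thesis .
qed

text \<open>Comes from splitting a j into two factors sqrt (a j). It is applied to
  \<open>\<psi>\<close> with u = 1, and to \<open>w\<close> with u = E / w, which compares an
  indicator row of unbounded length with summable weights.\<close>

lemma weighted_Cauchy_Schwarz:
  fixes a u x :: "'b \<Rightarrow> real"
  assumes "\<And>j. j \<in> J \<Longrightarrow> 0 \<le> a j" "\<And>j. j \<in> J \<Longrightarrow> 0 \<le> u j" "(\<Sum>j\<in>J. a j) \<le> s"
  shows "(\<Sum>j\<in>J. a j * u j * x j)\<^sup>2 \<le> s * (\<Sum>j\<in>J. a j * (u j)\<^sup>2 * (x j)\<^sup>2)"
proof -
  have "(\<Sum>j\<in>J. a j * u j * x j)\<^sup>2 = (\<Sum>j\<in>J. sqrt (a j) * (sqrt (a j) * u j * x j))\<^sup>2"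
    using assms(1) by (intro arg_cong[where f = "\<lambda>x. x\<^sup>2"] sum.cong refl)
      (simp flip: mult.assoc)
  also have "\<dots> \<le> (\<Sum>j\<in>J. (sqrt (a j))\<^sup>2) * (\<Sum>j\<in>J. (sqrt (a j) * u j * x j)\<^sup>2)"
    by (rule Cauchy_Schwarz_ineq_sum)
  also have "\<dots> = (\<Sum>j\<in>J. a j) * (\<Sum>j\<in>J. a j * (u j)\<^sup>2 * (x j)\<^sup>2)"
    using assms(1) by (simp add: power_mult_distrib)
  also have "\<dots> \<le> s * (\<Sum>j\<in>J. a j * (u j)\<^sup>2 * (x j)\<^sup>2)"
    using assms by (intro mult_right_mono sum_nonneg) auto
  finally show ?thesis .
qed

text \<open>Each row splits into a \<open>\<psi>\<close> part and an indicator part, and (a + b)^2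
  \<le> 2 a^2 + 2 b^2 gives the factors 2. For \<open>\<psi>\<close> row and column sums are both at
  most \<open>suminf \<psi>\<close>, hence its square; the indicators stay in column form, to be
  averaged later.\<close>

lemma sum_square_matrix_vector_le:
  fixes D :: "nat \<Rightarrow> nat \<Rightarrow> real" and \<psi> w x :: "nat \<Rightarrow> real" and E :: "nat \<Rightarrow> nat \<Rightarrow> bool"
  assumes D: "\<And>i k. k < i \<Longrightarrow> D i k = 0" "\<And>i k. 0 \<le> D i k" "\<And>i j. D i (i + j) \<le> of_bool (E i j) + \<psi> j"
    and \<psi>: "\<And>j. 0 \<le> \<psi> j" "summable \<psi>" and w: "\<And>j. 0 < w j" "summable w" and x: "\<And>k. 0 \<le> x k"
  shows "(\<Sum>i<n. (\<Sum>k<n. D i k * x k)\<^sup>2)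
    \<le> 2 * (suminf \<psi>)\<^sup>2 * (\<Sum>k<n. (x k)\<^sup>2)
      + 2 * suminf w * (\<Sum>k<n. \<Sum>j\<le>k. (x k)\<^sup>2 * (of_bool (E (k - j) j) / w j))"
proof -
  let ?e = "\<lambda>i j. of_bool (E i j) :: real"
  have row: "(\<Sum>k<n. D i k * x k)\<^sup>2
      \<le> 2 * suminf \<psi> * (\<Sum>j<n - i. \<psi> j * (x (i + j))\<^sup>2)
        + 2 * suminf w * (\<Sum>j<n - i. (x (i + j))\<^sup>2 * (?e i j / w j))" if i: "i < n" for i
  proof -
    let ?J = "{..<n - i}"
    let ?a = "\<Sum>j\<in>?J. \<psi> j * 1 * x (i + j)" and ?b = "\<Sum>j\<in>?J. w j * (?e i j / w j) * x (i + j)"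
    have "(\<Sum>k<n. D i k * x k) = (\<Sum>k\<in>{i..<n}. D i k * x k)"
      by (rule sum.mono_neutral_right) (auto simp: D(1))
    also have "\<dots> = (\<Sum>j\<in>?J. D i (i + j) * x (i + j))"
      by (rule sum.reindex_bij_witness[of _ "\<lambda>j. i + j" "\<lambda>k. k - i"]) auto
    finally have eq: "(\<Sum>k<n. D i k * x k) = (\<Sum>j\<in>?J. D i (i + j) * x (i + j))" .
    have "\<dots> \<le> (\<Sum>j\<in>?J. (?e i j + \<psi> j) * x (i + j))"
      using D(3) x by (intro sum_mono mult_right_mono) auto
    also have "\<dots> = ?a + ?b"
      using w(1)[THEN less_imp_neq[THEN not_sym]] by (simp add: distrib_right sum.distrib)
    finally have "(\<Sum>k<n. D i k * x k) \<le> ?a + ?b" by (simp add: eq)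
    moreover have "0 \<le> (\<Sum>k<n. D i k * x k)" using D(2) x by (intro sum_nonneg) auto
    ultimately have "(\<Sum>k<n. D i k * x k)\<^sup>2 \<le> (?a + ?b)\<^sup>2" by (intro power_mono)
    also have "\<dots> \<le> 2 * ?a\<^sup>2 + 2 * ?b\<^sup>2" using sum_squares_bound[of ?a ?b] by (simp add: power2_sum)
    also have "?a\<^sup>2 \<le> suminf \<psi> * (\<Sum>j\<in>?J. \<psi> j * 1\<^sup>2 * (x (i + j))\<^sup>2)"
      using \<psi> by (intro weighted_Cauchy_Schwarz sum_le_suminf) auto
    also have "?b\<^sup>2 \<le> suminf w * (\<Sum>j\<in>?J. w j * (?e i j / w j)\<^sup>2 * (x (i + j))\<^sup>2)"
      using w less_imp_le[OF w(1)] by (intro weighted_Cauchy_Schwarz sum_le_suminf) auto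
    \<comment> \<open>An indicator equals its square, so w (E / w)^2 = E / w.\<close>
    also have "(\<Sum>j\<in>?J. w j * (?e i j / w j)\<^sup>2 * (x (i + j))\<^sup>2) = (\<Sum>j\<in>?J. (x (i + j))\<^sup>2 * (?e i j / w j))"
      using w(1)[THEN less_imp_neq[THEN not_sym]]
      by (intro sum.cong refl) (auto simp: power2_eq_square)
    finally show ?thesis by (simp add: mult.assoc)
  qed
  have "(\<Sum>i<n. (\<Sum>k<n. D i k * x k)\<^sup>2)
      \<le> (\<Sum>i<n. 2 * suminf \<psi> * (\<Sum>j<n - i. \<psi> j * (x (i + j))\<^sup>2)
        + 2 * suminf w * (\<Sum>j<n - i. (x (i + j))\<^sup>2 * (?e i j / w j)))"
    by (intro sum_mono row) simp
  also have "\<dots> = 2 * suminf \<psi> * (\<Sum>i<n. \<Sum>j<n - i. \<psi> j * (x (i + j))\<^sup>2)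
        + 2 * suminf w * (\<Sum>i<n. \<Sum>j<n - i. (x (i + j))\<^sup>2 * (?e i j / w j))"
    by (simp add: sum.distrib sum_distrib_left)
  also have "\<dots> \<le> 2 * suminf \<psi> * (\<Sum>k<n. (x k)\<^sup>2 * suminf \<psi>)
        + 2 * suminf w * (\<Sum>k<n. \<Sum>j\<le>k. (x k)\<^sup>2 * (?e (k - j) j / w j))"
  proof (intro add_mono mult_left_mono)
    have "(\<Sum>i<n. \<Sum>j<n - i. \<psi> j * (x (i + j))\<^sup>2) = (\<Sum>k<n. (x k)\<^sup>2 * (\<Sum>j\<le>k. \<psi> j))"
      unfolding sum_triangle_swap by (simp add: sum_distrib_left sum_distrib_right mult.commute)
    also have "\<dots> \<le> (\<Sum>k<n. (x k)\<^sup>2 * suminf \<psi>)"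
      using \<psi> by (intro sum_mono mult_left_mono sum_le_suminf) auto
    finally show "(\<Sum>i<n. \<Sum>j<n - i. \<psi> j * (x (i + j))\<^sup>2) \<le> (\<Sum>k<n. (x k)\<^sup>2 * suminf \<psi>)" .
    show "(\<Sum>i<n. \<Sum>j<n - i. (x (i + j))\<^sup>2 * (?e i j / w j))
        \<le> (\<Sum>k<n. \<Sum>j\<le>k. (x k)\<^sup>2 * (?e (k - j) j / w j))"
      unfolding sum_triangle_swap by simp
  qed (use suminf_nonneg[OF \<psi>(2,1)] suminf_nonneg[OF w(2) less_imp_le[OF w(1)]] in auto)
  also have "(\<Sum>k<n. (x k)\<^sup>2 * suminf \<psi>) = (\<Sum>k<n. (x k)\<^sup>2) * suminf \<psi>"
    by (rule sum_distrib_right[symmetric])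
  finally show ?thesis by (simp add: power2_eq_square mult_ac)
qed

text \<open>Jensen's inequality is applied pointwise, and only the resulting linear bound
  \<open>R\<close> is integrated. The expectation then sees each event through its probability
  \<open>r j\<close> alone, whatever the dependence between the events.\<close>

lemma (in prob_space) convex_combination_tail:
  fixes x w r :: "nat \<Rightarrow> real" and E :: "nat \<Rightarrow> nat \<Rightarrow> 'a \<Rightarrow> bool"
  assumes E [measurable]: "\<And>i j. Measurable.pred M (E i j)"
    and r: "\<And>i j. \<P>(\<omega> in M. E i j \<omega>) = r j"
    and w: "\<And>j. 0 < w j" "summable w"
    and x: "(\<Sum>k<n. (x k)\<^sup>2) = s" "0 < s"
    and \<phi>: "convex_on {0..} \<phi>" "mono_on {0..} \<phi>" "\<And>y. 0 \<le> y \<Longrightarrow> 0 \<le> \<phi> y"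
    and M0: "\<And>j. r j * \<phi> ((1 / w j)\<^sup>2) \<le> M0"
    and z: "0 \<le> z" "0 < \<phi> z"
  shows "\<P>(\<omega> in M. (\<Sum>k<n. \<Sum>j\<le>k. (x k)\<^sup>2 * (of_bool (E (k - j) j \<omega>) / w j)) > s * suminf w * z)
    \<le> (\<phi> 0 + M0) / \<phi> z"
proof -
  let ?W = "suminf w"
  have W: "0 < ?W" using w by (intro suminf_pos) auto
  let ?A = "SIGMA k:{..<n}. {..k}"
  \<comment> \<open>The weights have mass at most 1, and the values y = 1 / w_j^2 restore the
    target: s * W * c * y = (x k)^2 / w_j, with W = \<open>suminf w\<close>.\<close>
  define c where "c = (\<lambda>(k, j). (x k)\<^sup>2 / s * (w j / ?W))"
  define e where "e = (\<lambda>(k, j) \<omega>. of_bool (E (k - j) j \<omega>) :: real)"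
  define y where "y = (\<lambda>(k :: nat, j). (1 / w j)\<^sup>2)"
  define R where "R \<omega> = \<phi> 0 + (\<Sum>a\<in>?A. c a * (e a \<omega> * \<phi> (y a)))" for \<omega>
  have c0: "0 \<le> c a" for a using W x(2) less_imp_le[OF w(1)] by (auto simp: c_def split: prod.split)
  have y0: "0 \<le> y a" for a by (auto simp: y_def split: prod.split)
  have c1: "(\<Sum>a\<in>?A. c a) \<le> 1"
  proof -
    have "(\<Sum>a\<in>?A. c a) = (\<Sum>k<n. (x k)\<^sup>2 / s * ((\<Sum>j\<le>k. w j) / ?W))"
      by (simp add: c_def sum_distrib_left sum_divide_distrib flip: sum.Sigma)
    also have "\<dots> \<le> (\<Sum>k<n. (x k)\<^sup>2 / s * 1)"
      using w W x(2) less_imp_le[OF w(1)]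
      by (intro sum_mono mult_left_mono) (auto intro!: sum_le_suminf)
    also have "\<dots> = 1" using x by (simp flip: sum_divide_distrib)
    finally show ?thesis .
  qed
  have mean_e: "(\<integral>\<omega>. e a \<omega> \<partial>M) = r (snd a)" "integrable M (e a)" for a
  proof -
    obtain k j where a: "a = (k, j)" by (cases a)
    have "e a = (\<lambda>\<omega>. indicator {\<omega>. E (k - j) j \<omega>} \<omega>)"
      by (simp add: a e_def indicator_def fun_eq_iff)
    moreover have "(\<integral>\<omega>. indicator {\<omega>. E (k - j) j \<omega>} \<omega> \<partial>M) = prob ({\<omega>. E (k - j) j \<omega>} \<inter> space M)"
      by simp
    moreover have "{\<omega>. E (k - j) j \<omega>} \<inter> space M = {\<omega> \<in> space M. E (k - j) j \<omega>}" by auto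
    ultimately show "(\<integral>\<omega>. e a \<omega> \<partial>M) = r (snd a)" using r by (simp add: a)
    show "integrable M (e a)"
      by (rule integrable_const_bound[where B = 1]) (auto simp: a e_def)
  qed
  have intR: "integrable M R"
    unfolding R_def using mean_e(2)
    by (intro Bochner_Integration.integrable_add Bochner_Integration.integrable_sum
        integrable_mult_right integrable_mult_left) auto
  have R_nonneg: "0 \<le> R \<omega>" for \<omega>
    using c0 \<phi>(3) y0 by (auto simp: R_def e_def intro!: add_nonneg_nonneg sum_nonneg mult_nonneg_nonneg)
  have R_ge: "\<phi> z \<le> R \<omega>"
    if "s * ?W * z < (\<Sum>k<n. \<Sum>j\<le>k. (x k)\<^sup>2 * (of_bool (E (k - j) j \<omega>) / w j))" for \<omega>
  proof -
    have "(\<Sum>k<n. \<Sum>j\<le>k. (x k)\<^sup>2 * (of_bool (E (k - j) j \<omega>) / w j))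
        = (\<Sum>(k, j)\<in>?A. (x k)\<^sup>2 * (of_bool (E (k - j) j \<omega>) / w j))"
      by (simp add: sum.Sigma)
    also have "\<dots> = s * ?W * (\<Sum>a\<in>?A. c a * (e a \<omega> * y a))"
      unfolding sum_distrib_left using W x(2) w(1)[THEN less_imp_neq[THEN not_sym]]
      by (intro sum.cong refl) (auto simp: c_def e_def y_def power2_eq_square)
    finally have "z < (\<Sum>a\<in>?A. c a * (e a \<omega> * y a))"
      using that W x(2) by simp
    then have "\<phi> z \<le> \<phi> (\<Sum>a\<in>?A. c a * (e a \<omega> * y a))"
      using z by (intro mono_onD[OF \<phi>(2)]) auto
    also have "\<dots> \<le> (1 - (\<Sum>a\<in>?A. c a)) * \<phi> 0 + (\<Sum>a\<in>?A. c a * \<phi> (e a \<omega> * y a))"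
      using c0 c1 y0 \<phi>(1) by (intro convex_on_subweighted_sum) (auto simp: e_def)
    \<comment> \<open>As \<open>e a\<close> is 0 or 1, \<phi> (e y) \<le> \<phi> 0 + e * \<phi>
      y.\<close>
    also have "\<dots> \<le> (1 - (\<Sum>a\<in>?A. c a)) * \<phi> 0 + (\<Sum>a\<in>?A. c a * (\<phi> 0 + e a \<omega> * \<phi> (y a)))"
      using c0 \<phi>(3) y0 by (intro add_left_mono sum_mono mult_left_mono) (auto simp: e_def)
    also have "\<dots> = R \<omega>"
      by (simp add: R_def distrib_left sum.distrib left_diff_distrib flip: sum_distrib_right)
    finally show ?thesis .
  qed
  have "expectation R = \<phi> 0 + (\<Sum>a\<in>?A. c a * (r (snd a) * \<phi> (y a)))"
    unfolding R_def using mean_e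
    by (subst Bochner_Integration.integral_add)
      (auto simp: prob_space intro!: Bochner_Integration.integral_sum[THEN trans] sum.cong)
  also have "\<dots> \<le> \<phi> 0 + (\<Sum>a\<in>?A. c a * M0)"
    using M0 c0 by (intro add_left_mono sum_mono mult_left_mono) (auto simp: y_def)
  also have "\<dots> \<le> \<phi> 0 + 1 * M0"
  proof -
    \<comment> \<open>The mass of the weights is only at most 1, so replacing it by 1 requires M0
      \<ge> 0, read off from the bound at j = 0.\<close>
    have "0 \<le> r 0" unfolding r[of 0 0, symmetric] by simp
    then have "0 \<le> r 0 * \<phi> ((1 / w 0)\<^sup>2)" using \<phi>(3) by simp
    then have "0 \<le> M0" using M0[of 0] by linarith
    with c1 show ?thesis
      unfolding sum_distrib_right[symmetric] by (intro add_left_mono mult_right_mono)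
  qed
  finally have ER: "expectation R \<le> \<phi> 0 + M0" by simp
  have "\<P>(\<omega> in M. (\<Sum>k<n. \<Sum>j\<le>k. (x k)\<^sup>2 * (of_bool (E (k - j) j \<omega>) / w j)) > s * ?W * z)
      \<le> \<P>(\<omega> in M. R \<omega> \<ge> \<phi> z)"
    using R_ge intR by (intro finite_measure_mono) auto
  also have "\<dots> \<le> expectation R / \<phi> z"
    by (rule integral_Markov_inequality_measure[where A = "{}"]) (use intR R_nonneg z in auto)
  also have "\<dots> \<le> (\<phi> 0 + M0) / \<phi> z" using ER z by (intro divide_right_mono) auto
  finally show ?thesis .
qed

section \<open>Combining the martingale bound with the tail of the quadratic variation\<close>

context finite_config_prob
begin

text \<open>The deviation is measured in units of the norm of the variation, so the bound is free of
  \<open>g\<close> and \<open>n\<close>. Of the two factors \<open>suminf w\<close> in front of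
  \<open>z\<close>, one comes from Cauchy-Schwarz and the other normalises the convex combination.
  The choice of \<open>\<phi>\<close>, \<open>w\<close> and \<open>z\<close> is left to the two
  applications.\<close>

lemma coupling_tail:
  fixes M :: "'b measure" and L0 :: "'b \<Rightarrow> ennreal" and w \<psi> :: "nat \<Rightarrow> real"
  defines "r \<equiv> \<lambda>j. measure M {\<omega> \<in> space M. of_nat j \<le> L0 \<omega>}"
  assumes K: "conditional_versions P K" and Q: "maximal_coupling_family K Q"
    and L: "common_law P L M L0" and L0: "L0 \<in> borel_measurable M"
    and ctl: "controlled_by Q L \<psi>"
    and \<psi>: "\<And>j. 0 \<le> \<psi> j" "summable \<psi>" and w: "\<And>j. 0 < w j" "summable w"
    and \<phi>: "convex_on {0..} \<phi>" "mono_on {0..} \<phi>" "\<And>y. 0 \<le> y \<Longrightarrow> 0 \<le> \<phi> y"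
    and M0: "\<And>j. r j * \<phi> ((1 / w j)\<^sup>2) \<le> M0"
    and z: "0 < z" "0 < \<phi> z"
    and g: "local_fun n g" and nz: "0 < ell2_norm (variation g)" and t: "0 < t"
  shows "\<P>(\<sigma> in P. \<bar>g \<sigma> - expectation g\<bar> > t * ell2_norm (variation g))
    \<le> 2 * exp (- t\<^sup>2 / (4 * (2 * (suminf \<psi>)\<^sup>2 + 2 * (suminf w)\<^sup>2 * z))) + (\<phi> 0 + M0) / \<phi> z"
proof -
  let ?x = "variation g" and ?N = "ell2_norm (variation g)"
  let ?E = "\<lambda>i j \<sigma>. of_nat j \<le> L i \<sigma>"
  let ?Z = "\<lambda>\<sigma>. \<Sum>k<n. \<Sum>j\<le>k. (?x k)\<^sup>2 * (of_bool (?E (k - j) j \<sigma>) / w j)"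
  define d where "d i \<sigma> = (\<Sum>k<n. coupling_matrix Q \<sigma> i k * ?x k)" for i \<sigma>
  define v where "v = 2 * (suminf \<psi>)\<^sup>2 + 2 * (suminf w)\<^sup>2 * z"
  have W: "0 < suminf w" using w by (intro suminf_pos) auto
  have v: "0 < v" using W z by (auto simp: v_def intro!: add_nonneg_pos)
  have d_local: "local_fun i (d i)" for i
    using coupling_matrix_cong[OF Q] by (simp add: local_fun_def d_def)
  have L_meas [measurable]: "L i \<in> borel_measurable P" for i
    using L by (simp add: common_law_def)
  note L0 [measurable] local_fun_measurable[OF g, measurable] local_fun_measurable[OF d_local, measurable]
  have law: "\<P>(\<sigma> in P. ?E i j \<sigma>) = r j" for i j
  proof -
    have "\<P>(\<sigma> in P. ?E i j \<sigma>) = measure (distr P borel (L i)) {of_nat j..}"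
      by (subst measure_distr) (auto intro!: arg_cong[where f = prob])
    also have "\<dots> = measure (distr M borel L0) {of_nat j..}"
      using L by (simp add: common_law_def)
    also have "\<dots> = r j"
      unfolding r_def by (subst measure_distr) (auto intro!: arg_cong[where f = "measure M"])
    finally show ?thesis .
  qed
  have B_le: "(\<Sum>i<n. (d i \<sigma>)\<^sup>2) \<le> 2 * (suminf \<psi>)\<^sup>2 * ?N\<^sup>2 + 2 * suminf w * ?Z \<sigma>" for \<sigma>
    unfolding d_def ell2_norm_variation(1)[OF g]
    by (intro sum_square_matrix_vector_le \<psi> w variation_nonneg[OF g] coupling_matrix_nonneg)
      (use ctl in \<open>auto simp: controlled_by_def coupling_matrix_def[of _ _ _ j for j]\<close>)
  have "\<P>(\<sigma> in P. ?Z \<sigma> > ?N\<^sup>2 * suminf w * z) \<le> (\<phi> 0 + M0) / \<phi> z"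
    using nz z by (intro convex_combination_tail[where E = ?E and r = r and x = ?x] law w \<phi> M0
        ell2_norm_variation(1)[OF g, symmetric]) auto
  moreover have "\<P>(\<sigma> in P. \<bar>g \<sigma> - expectation g\<bar> > t * ?N \<and> (\<Sum>i<n. (d i \<sigma>)\<^sup>2) \<le> v * ?N\<^sup>2)
      \<le> 2 * exp (- (t * ?N)\<^sup>2 / (4 * (v * ?N\<^sup>2)))"
    using t nz v by (intro martingale_tail[OF g d_local])
      (auto simp: d_def intro!: cyl_mean_osc[OF K Q g])
  moreover have "- (t * ?N)\<^sup>2 / (4 * (v * ?N\<^sup>2)) = - t\<^sup>2 / (4 * v)"
    using nz by (simp add: power_mult_distrib)
  moreover have "\<P>(\<sigma> in P. \<bar>g \<sigma> - expectation g\<bar> > t * ?N)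
      \<le> prob ({\<sigma> \<in> space P. \<bar>g \<sigma> - expectation g\<bar> > t * ?N \<and> (\<Sum>i<n. (d i \<sigma>)\<^sup>2) \<le> v * ?N\<^sup>2}
         \<union> {\<sigma> \<in> space P. ?Z \<sigma> > ?N\<^sup>2 * suminf w * z})" (is "_ \<le> prob (?A \<union> ?B)")
  proof (rule finite_measure_mono)
    show "{\<sigma> \<in> space P. \<bar>g \<sigma> - expectation g\<bar> > t * ?N} \<subseteq> ?A \<union> ?B"
    proof
      fix \<sigma> assume s: "\<sigma> \<in> {\<sigma> \<in> space P. \<bar>g \<sigma> - expectation g\<bar> > t * ?N}"
      show "\<sigma> \<in> ?A \<union> ?B"
      proof (cases "?Z \<sigma> > ?N\<^sup>2 * suminf w * z")
        case False
        have "2 * suminf w * ?Z \<sigma> \<le> 2 * suminf w * (?N\<^sup>2 * suminf w * z)"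
          using False W by (intro mult_left_mono) auto
        then have "(\<Sum>i<n. (d i \<sigma>)\<^sup>2) \<le> v * ?N\<^sup>2"
          using B_le[of \<sigma>] by (simp add: v_def algebra_simps power2_eq_square)
        with s show ?thesis by auto
      qed (use s in auto)
    qed
    show "?A \<union> ?B \<in> sets P" by measurable
  qed
  moreover have "prob (?A \<union> ?B) \<le> prob ?A + prob ?B"
    by (intro measure_Un_le) measurable
  ultimately show ?thesis by (simp add: v_def)
qed

end

section \<open>Polynomial and stretched exponential bounds\<close>

text \<open>At the endpoint x = 0 the claim reduces to t^p \<le> t; the rest is convexity on the
  open half-line.\<close>

lemma convex_on_powr_nonneg:
  assumes "1 \<le> p"
  shows "convex_on {0..} (\<lambda>x::real. x powr p)"
proof (rule convex_on_linorderI)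
  fix t x y :: real
  assume t: "0 < t" "t < 1" and xy: "x \<in> {0..}" "y \<in> {0..}" "x < y"
  show "((1 - t) *\<^sub>R x + t *\<^sub>R y) powr p \<le> (1 - t) * x powr p + t * y powr p"
  proof (cases "x = 0")
    case True
    have "t powr p \<le> t powr 1" using assms t by (intro powr_mono') auto
    then have "t powr p * y powr p \<le> t * y powr p" using t by (intro mult_right_mono) auto
    then show ?thesis using True t xy by (simp add: powr_mult)
  next
    case False
    then show ?thesis using convex_onD[OF powr_convex[OF assms], of t x y] t xy by simp
  qed
qed simp

section \<open>Young functions and exponential estimates\<close>

lemma young_shift_powr:
  assumes "0 < a" "a < 1"
  shows "0 < young_shift a" "young_shift a powr a = (1 - a) / a"
  using assms by (simp_all add: young_shift_def powr_powr)

lemma young_shift_nonneg: "0 \<le> young_shift a"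
  by (simp add: young_shift_def)

lemma young_fun_mono: "0 < r \<Longrightarrow> mono_on {0..} (young_fun r)"
  by (auto simp: mono_on_def young_fun_def young_shift_nonneg intro!: powr_mono2)

lemma young_fun_nonneg: "0 < r \<Longrightarrow> 0 \<le> young_fun r x"
  by (auto simp: young_fun_def young_shift_nonneg intro!: powr_mono2)

text \<open>The second derivative has the sign of a u^a - (1 - a), where u = k y +
  \<open>young_shift a\<close>. The shift is exactly the value of u at which this vanishes, so
  convexity holds from y = 0 on.\<close>

lemma convex_on_exp_powr:
  fixes a k :: real
  assumes a: "0 < a" "a < 1" and k: "0 < k"
  shows "convex_on {0..} (\<lambda>y. exp ((k * y + young_shift a) powr a))"
proof -
  define u where "u y = k * y + young_shift a" for y
  define f where "f y = exp (u y powr a)" for y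
  define f' where "f' y = f y * (a * k * u y powr (a - 1))" for y
  define f'' where "f'' y = f' y * (a * k * u y powr (a - 1)) + f y * (a * k * ((a - 1) * k * u y powr (a - 2)))" for y
  have "convex_on {0..} f"
  proof (rule f''_ge0_imp_convex[where f' = f' and f'' = f''])
    fix y :: real assume "y \<in> {0..}"
    then have y: "0 \<le> y" by simp
    have h: "young_shift a \<le> u y" using y k by (simp add: u_def)
    then have u: "0 < u y" using young_shift_powr(1)[OF a] by linarith
    have du: "(u has_real_derivative k) (at y)"
      unfolding u_def by (auto intro!: derivative_eq_intros)
    show df: "(f has_real_derivative f' y) (at y)"
      unfolding f_def f'_def using u by (auto intro!: derivative_eq_intros du simp: f_def)
    show "(f' has_real_derivative f'' y) (at y)"
      unfolding f'_def f''_def using u by (auto intro!: derivative_eq_intros du df simp: f'_def)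
    have "(1 - a) / a \<le> u y powr a"
      using powr_mono2[of a "young_shift a" "u y"] h a young_shift_nonneg by (simp add: young_shift_powr)
    then have "0 \<le> a * u y powr a - (1 - a)" using a by (simp add: field_simps)
    then have "0 \<le> f y * (a * k\<^sup>2 * u y powr (a - 2) * (a * u y powr a - (1 - a)))"
      using a by (simp add: f_def)
    also have "\<dots> = f'' y"
    proof -
      have "u y powr (a - 1) * u y powr (a - 1) = u y powr (a - 2) * u y powr a"
        by (simp flip: powr_add)
      then show ?thesis unfolding f''_def f'_def by (simp add: power2_eq_square) algebra
    qed
    finally show "0 \<le> f'' y" .
  qed simp
  then show ?thesis by (simp add: f_def[abs_def] u_def)
qed

text \<open>Markov's inequality in product form, so that f y = 0 is harmless. Where Z is infinite so
  is the integrand, and values of \<open>f\<close> are compared only at the remaining points of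
  \<open>A\<close>.\<close>

lemma extend_ennreal_Markov:
  assumes M: "prob_space M" and f: "mono_on {0..} f" "\<And>x. 0 \<le> x \<Longrightarrow> 0 \<le> f x"
    and A: "A \<in> sets M" "\<And>\<omega>. \<omega> \<in> A \<Longrightarrow> ennreal y \<le> Z \<omega>" and y: "0 \<le> y" and I: "0 \<le> I"
    and le: "(\<integral>\<^sup>+\<omega>. extend_ennreal f (Z \<omega>) \<partial>M) \<le> ennreal I"
  shows "measure M A * f y \<le> I"
proof -
  interpret prob_space M by (rule M)
  have "ennreal (f y) * emeasure M A = (\<integral>\<^sup>+\<omega>. ennreal (f y) * indicator A \<omega> \<partial>M)"
    using A by (simp add: nn_integral_cmult_indicator)
  also have "\<dots> \<le> (\<integral>\<^sup>+\<omega>. extend_ennreal f (Z \<omega>) \<partial>M)"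
  proof (rule nn_integral_mono)
    fix \<omega>
    show "ennreal (f y) * indicator A \<omega> \<le> extend_ennreal f (Z \<omega>)"
    proof (cases "\<omega> \<in> A \<and> Z \<omega> \<noteq> \<infinity>")
      case True
      then have "y \<le> enn2real (Z \<omega>)"
        using A(2)[of \<omega>] y by (metis enn2real_ennreal enn2real_mono infinity_ennreal_def top.not_eq_extremum)
      then have "f y \<le> f (enn2real (Z \<omega>))"
        using y by (intro mono_onD[OF f(1)]) auto
      with True show ?thesis by (simp add: extend_ennreal_def ennreal_leI)
    qed (auto simp: extend_ennreal_def)
  qed
  also note le
  finally have "ennreal (f y * prob A) \<le> ennreal I"
    using f(2)[OF y] by (simp add: emeasure_eq_measure ennreal_mult)
  then show ?thesis using I by (simp add: mult.commute)
qed

text \<open>For s \<ge> 1 the denominator is at most a multiple of s^(2 - \<eta>), and s^2 / s^(2 -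
  \<eta>) = s^\<eta>. In the applications \<open>A\<close> and \<open>B\<close> are the squares of
  \<open>suminf \<psi>\<close> and \<open>suminf w\<close>.\<close>

lemma subgaussian_term_le:
  fixes s \<eta> A B :: real
  assumes s: "1 \<le> s" and \<eta>: "0 < \<eta>" "\<eta> < 2" and AB: "0 \<le> A" "0 < B"
  shows "exp (- s\<^sup>2 / (4 * (2 * A + 2 * B * s powr (2 - \<eta>)))) \<le> exp (- (1 / (8 * A + 8 * B)) * s powr \<eta>)"
proof -
  let ?u = "s powr (2 - \<eta>)"
  have u: "1 \<le> ?u" using s \<eta> by (intro ge_one_powr_ge_zero) auto
  have "?u * s powr \<eta> = s powr 2" by (simp flip: powr_add)
  then have s2: "s\<^sup>2 = ?u * s powr \<eta>" using s by (simp add: powr_numeral)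
  have "2 * A * 1 + 2 * B * ?u \<le> 2 * A * ?u + 2 * B * ?u"
    using u AB by (intro add_mono mult_left_mono) auto
  then have "4 * (2 * A + 2 * B * ?u) \<le> (8 * A + 8 * B) * ?u" by (simp add: algebra_simps)
  then have "s\<^sup>2 / ((8 * A + 8 * B) * ?u) \<le> s\<^sup>2 / (4 * (2 * A + 2 * B * ?u))"
    using u AB by (intro divide_left_mono mult_pos_pos add_nonneg_pos) auto
  moreover have "s\<^sup>2 / ((8 * A + 8 * B) * ?u) = (1 / (8 * A + 8 * B)) * s powr \<eta>"
    using u unfolding s2 by simp
  ultimately show ?thesis by simp
qed

text \<open>Follows from exp x \<ge> (1 + x / m)^m \<ge> (x / m)^m with x = c s^\<eta> and m above a
  / \<eta>.\<close>

lemma exp_powr_le_powr: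
  fixes c \<eta> a :: real
  assumes c: "0 < c" and \<eta>: "0 < \<eta>"
  obtains K where "0 < K" "\<And>s. 1 \<le> s \<Longrightarrow> exp (- c * s powr \<eta>) \<le> K / s powr a"
proof -
  obtain m :: nat where m: "a / \<eta> < real m" "0 < m"
    using reals_Archimedean2[of "max 0 (a / \<eta>)"] by (metis gr0I less_irrefl max_less_iff_conj of_nat_0)
  show thesis
  proof (rule that)
    show "0 < (m / c) ^ m" using m c by simp
    fix s :: real assume s: "1 \<le> s"
    let ?x = "c * s powr \<eta>"
    have "s powr a \<le> s powr (\<eta> * m)"
      using s m \<eta> by (intro powr_mono) (auto simp: field_simps)
    also have "\<dots> = (s powr \<eta>) ^ m" using s by (simp add: powr_powr[symmetric] powr_realpow)
    also have "\<dots> = (m / c) ^ m * (?x / m) ^ m"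
      using m c by (simp flip: power_mult_distrib)
    also have "(?x / m) ^ m \<le> (1 + ?x / m) ^ m" using c by (intro power_mono) auto
    also have "\<dots> \<le> exp ?x"
    proof (rule exp_ge_one_plus_x_over_n_power_n)
      have "- real m \<le> 0" "0 \<le> ?x" using c by auto
      then show "- real m \<le> ?x" by linarith
    qed (use m in simp)
    finally have "s powr a \<le> (m / c) ^ m * exp ?x" using m c by simp
    then have "exp (- ?x) * s powr a \<le> exp (- ?x) * ((m / c) ^ m * exp ?x)"
      by (intro mult_left_mono) auto
    also have "\<dots> = (m / c) ^ m" by (simp add: exp_minus)
    finally show "exp (- c * s powr \<eta>) \<le> (m / c) ^ m / s powr a"
      using s by (simp add: pos_le_divide_eq)
  qed
qed

text \<open>Above the threshold \<open>u0\<close> half of the exponent pays for \<open>N\<close>;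
  below it, c' \<le> ln 4 / u0 makes the right-hand side at least 1. This produces the prefactor 4
  of the stretched exponential bound.\<close>

lemma exp_bound_absorb_constant:
  fixes c N :: real
  assumes c: "0 < c" and N: "1 \<le> N"
  obtains c' where "0 < c'"
    "\<And>u P. 0 < u \<Longrightarrow> P \<le> 1 \<Longrightarrow> (1 \<le> u \<Longrightarrow> P \<le> N * exp (- c * u)) \<Longrightarrow> P \<le> 4 * exp (- c' * u)"
proof -
  define u0 where "u0 = max 1 (2 * ln N / c)"
  define c' where "c' = min (c / 2) (ln 4 / u0)"
  have u0: "1 \<le> u0" by (simp add: u0_def)
  have "c' \<le> c / 2" unfolding c'_def by (rule min.cobounded1)
  show thesis
  proof (rule that)
    show "0 < c'" using c u0 by (simp add: c'_def)
    fix u P :: real assume u: "0 < u" and P: "P \<le> 1" "1 \<le> u \<Longrightarrow> P \<le> N * exp (- c * u)"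
    show "P \<le> 4 * exp (- c' * u)"
    proof (cases "u0 \<le> u")
      case True
      then have "2 * ln N \<le> c * u" using c by (simp add: u0_def field_simps)
      then have "N \<le> exp (c * u / 2)" using N by (simp add: ln_ge_iff flip: ln_le_cancel_iff)
      then have "N * exp (- c * u) \<le> exp (c * u / 2) * exp (- c * u)" by simp
      also have "\<dots> = exp (- (c / 2) * u)" by (simp flip: exp_add)
      also have "\<dots> \<le> exp (- c' * u)"
        using u \<open>c' \<le> c / 2\<close> by simp
      also have "\<dots> \<le> 4 * exp (- c' * u)" by simp
      finally show ?thesis using P(2) True u0 by linarith
    next
      case False
      have "c' * u \<le> ln 4 / u0 * u0"
        using False u u0 by (intro mult_mono) (auto simp: c'_def)
      then have "exp (- ln 4) \<le> exp (- c' * u)" using u0 by simp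
      then have "1 / 4 \<le> exp (- c' * u)" by (simp add: exp_minus)
      then show ?thesis using P(1) by linarith
    qed
  qed
qed

lemma summable_Suc_powr: "1 < b \<Longrightarrow> summable (\<lambda>j. real (Suc j) powr (- b))"
  using summable_real_powr_iff[of "- b"] by (subst summable_Suc_iff) simp

text \<open>Covers constant functions, for which the deviation cannot be rescaled by the norm and
  the right-hand sides of both estimates are 0.\<close>

lemma (in finite_config_prob) deviation_eq_0:
  assumes g: "local_fun n g" and N: "ell2_norm (variation g) = 0" and t: "0 < t"
  shows "\<P>(\<sigma> in P. \<bar>g \<sigma> - expectation g\<bar> > t) = 0"
proof -
  have "g \<sigma> = g undefined" for \<sigma>
    using variation_telescope[OF g, of \<sigma> undefined] N by (simp add: ell2_norm_variation_eq_0_iff[OF g])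
  then have *: "g = (\<lambda>_. g undefined)" by blast
  show ?thesis using t by (subst (1 2) *) (simp add: prob_space)
qed

lemma Suc_powr_le:
  assumes "0 < a"
  shows "real (Suc j) powr a \<le> 1 + 2 powr a * real j powr a"
proof (cases "j = 0")
  case False
  then have "real (Suc j) powr a \<le> (2 * real j) powr a" using assms by (intro powr_mono2) auto
  then show ?thesis by (simp add: powr_mult)
qed simp

lemma (in finite_config_prob) polynomial_tail:
  fixes M :: "'b measure" and L0 :: "'b \<Rightarrow> ennreal" and \<psi> :: "nat \<Rightarrow> real"
  assumes M: "prob_space M" and L0: "L0 \<in> borel_measurable M"
    and \<psi>: "\<And>j. 0 \<le> \<psi> j" "summable \<psi>"
    and p: "1 \<le> p" and \<epsilon>: "0 < \<epsilon>"
    and fin: "(\<integral>\<^sup>+\<omega>. extend_ennreal (\<lambda>x. x powr (2 * real p + \<epsilon>)) (L0 \<omega>) \<partial>M) < \<infinity>"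
  shows "\<exists>C>0. \<forall>K Q L.
    conditional_versions P K \<longrightarrow> maximal_coupling_family K Q \<longrightarrow>
    common_law P L M L0 \<longrightarrow> controlled_by Q L \<psi> \<longrightarrow>
    (\<forall>n\<ge>1. \<forall>g. local_fun n g \<longrightarrow> (\<forall>t>0.
       \<P>(\<sigma> in P. \<bar>g \<sigma> - (\<integral>\<eta>. g \<eta> \<partial>P)\<bar> > t)
         \<le> C * (ell2_norm (variation g) ^ (2 * p) / t ^ (2 * p))))"
proof -
  interpret M: prob_space M by (rule M)
  note L0 [measurable]
  define a where "a = 2 * real p + \<epsilon>"
  \<comment> \<open>\<open>q\<close> lies strictly between 2 p and the available moment
    \<open>a\<close>: q < a makes \<open>w\<close> summable, and q > 2 p makes \<open>\<eta>\<close>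
    positive.\<close>
  define q where "q = 2 * real p + \<epsilon> / 2"
  \<comment> \<open>With this decay \<phi> (1 / w_j^2) = (j + 1)^a, which the moment of order
    \<open>a\<close> controls against \<open>r j\<close>.\<close>
  define w where "w j = real (Suc j) powr (- (a / q))" for j
  define \<phi> where "\<phi> y = y powr (q / 2)" for y :: real
  \<comment> \<open>Solves (2 - \<eta>) q / 2 = 2 p, so that \<phi> (s^(2 - \<eta>)) = s^(2
    p).\<close>
  define \<eta> where "\<eta> = 2 - 4 * real p / q"
  define r where "r j = measure M {\<omega> \<in> space M. of_nat j \<le> L0 \<omega>}" for j
  have q: "2 * real p < q" "q < a" "2 < q" using p \<epsilon> by (auto simp: q_def a_def)
  have \<eta>: "0 < \<eta>" "\<eta> < 2" using p q by (auto simp: \<eta>_def field_simps)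
  obtain I where I: "0 \<le> I" "(\<integral>\<^sup>+\<omega>. extend_ennreal (\<lambda>x. x powr a) (L0 \<omega>) \<partial>M) = ennreal I"
    using fin by (auto simp: a_def less_top_ennreal)
  have r_le: "r j * real j powr a \<le> I" for j
    unfolding r_def using q p I
    by (intro extend_ennreal_Markov[OF M, where Z = L0])
      (auto simp: mono_on_def ennreal_of_nat_eq_real_of_nat intro!: powr_mono2)
  \<comment> \<open>The summand 1 pays for the shift from j to j + 1, using r j \<le> 1.\<close>
  define C1 where "C1 = 1 + 2 powr a * I"
  have M0: "r j * \<phi> ((1 / w j)\<^sup>2) \<le> C1" for j
  proof -
    have "1 / w j = real (Suc j) powr (a / q)" by (simp add: w_def powr_minus_divide)
    then have "(1 / w j)\<^sup>2 = real (Suc j) powr (2 * (a / q))"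
      by (simp add: power2_eq_square flip: powr_add)
    then have "\<phi> ((1 / w j)\<^sup>2) = real (Suc j) powr a"
      using q by (simp add: \<phi>_def powr_powr)
    moreover have "r j * real (Suc j) powr a \<le> r j * (1 + 2 powr a * real j powr a)"
      using q p by (intro mult_left_mono Suc_powr_le) (auto simp: r_def)
    moreover have "r j * 1 + 2 powr a * (r j * real j powr a) \<le> 1 + 2 powr a * I"
      using r_le[of j] by (intro add_mono mult_left_mono) (auto simp: r_def)
    ultimately show ?thesis by (simp add: C1_def algebra_simps)
  qed
  have w: "\<And>j. 0 < w j" "summable w"
    using summable_Suc_powr[of "a / q"] q by (auto simp: w_def[abs_def])
  have W: "0 < suminf w" using w by (intro suminf_pos) auto
  define c where "c = 1 / (8 * (suminf \<psi>)\<^sup>2 + 8 * (suminf w)\<^sup>2)"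
  have c: "0 < c" using W by (auto simp: c_def intro!: add_nonneg_pos)
  obtain K0 where K0: "0 < K0" "\<And>s. 1 \<le> s \<Longrightarrow> exp (- c * s powr \<eta>) \<le> K0 / s powr (2 * real p)"
    using exp_powr_le_powr[OF c \<eta>(1)] by blast
  have C1: "1 \<le> C1" using I by (simp add: C1_def)
  show ?thesis
  \<comment> \<open>The witness is fixed before the kernel, the couplings and \<open>L\<close>, and
    is therefore uniform in them as well as in \<open>n\<close> and \<open>g\<close>.\<close>
  proof (intro exI[of _ "2 * K0 + C1"] conjI allI impI)
    show "0 < 2 * K0 + C1" using K0 C1 by simp
    fix K Q L n and g :: "(nat \<Rightarrow> 'a) \<Rightarrow> real" and t :: real
    assume ass: "conditional_versions P K" "maximal_coupling_family K Q" "common_law P L M L0"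
      "controlled_by Q L \<psi>" and g: "local_fun n g" and t: "0 < t"
    let ?N = "ell2_norm (variation g)"
    show "\<P>(\<sigma> in P. \<bar>g \<sigma> - expectation g\<bar> > t) \<le> (2 * K0 + C1) * (?N ^ (2 * p) / t ^ (2 * p))"
    proof (cases "?N = 0")
      case True
      then show ?thesis using deviation_eq_0[OF g True t] K0 C1 t by simp
    next
      case False
      then have N: "0 < ?N" using ell2_norm_variation(2)[OF g] by simp
      define s where "s = t / ?N"
      have s: "0 < s" "t = s * ?N" using N t by (simp_all add: s_def)
      have "?N ^ (2 * p) / t ^ (2 * p) = 1 / s ^ (2 * p)" by (simp add: s_def power_divide)
      then have ratio: "?N ^ (2 * p) / t ^ (2 * p) = 1 / s powr (2 * real p)"
        using powr_realpow[OF s(1), of "2 * p"] by simp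
      show ?thesis
      proof (cases "1 \<le> s")
        case True
        let ?z = "s powr (2 - \<eta>)"
        have sub: "exp (- s\<^sup>2 / (4 * (2 * (suminf \<psi>)\<^sup>2 + 2 * (suminf w)\<^sup>2 * ?z))) \<le> exp (- c * s powr \<eta>)"
          unfolding c_def using W by (intro subgaussian_term_le True \<eta>) auto
        have \<phi>z: "\<phi> ?z = s powr (2 * real p)" using q by (simp add: \<phi>_def powr_powr \<eta>_def)
        have "\<P>(\<sigma> in P. \<bar>g \<sigma> - expectation g\<bar> > s * ?N)
            \<le> 2 * exp (- s\<^sup>2 / (4 * (2 * (suminf \<psi>)\<^sup>2 + 2 * (suminf w)\<^sup>2 * ?z))) + (\<phi> 0 + C1) / \<phi> ?z"
          using q s(1) \<phi>z M0
          by (intro coupling_tail[OF ass(1-3) L0 ass(4) \<psi> w _ _ _ _ _ _ g N])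
            (auto simp: \<phi>_def[abs_def] r_def mono_on_def intro!: convex_on_powr_nonneg powr_mono2)
        also have "\<dots> \<le> 2 * (K0 / s powr (2 * real p)) + C1 / s powr (2 * real p)"
          unfolding \<phi>z
          by (intro add_mono mult_left_mono order_trans[OF sub K0(2)[OF True]]) (auto simp: \<phi>_def)
        finally show ?thesis unfolding ratio s(2)[symmetric] by (simp add: add_divide_distrib)
      next
        \<comment> \<open>For s < 1 the right-hand side is at least C1 \<ge> 1, so the bound is
          trivial.\<close>
        case False
        then have "s powr (2 * real p) \<le> 1" using s p by (intro powr_le1) auto
        then have "1 \<le> 1 / s powr (2 * real p)" using s by simp
        moreover have "1 \<le> 2 * K0 + C1" using K0 C1 by simp
        ultimately have "1 * 1 \<le> (2 * K0 + C1) * (1 / s powr (2 * real p))"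
          by (intro mult_mono) auto
        then show ?thesis unfolding ratio by (intro order_trans[OF prob_le_1]) simp
      qed
    qed
  qed
qed

lemma (in finite_config_prob) stretched_exponential_tail:
  fixes M :: "'b measure" and L0 :: "'b \<Rightarrow> ennreal" and \<psi> :: "nat \<Rightarrow> real"
  assumes M: "prob_space M" and L0: "L0 \<in> borel_measurable M"
    and \<psi>: "\<And>j. 0 \<le> \<psi> j" "summable \<psi>"
    and \<rho>: "0 < \<rho>" "\<rho> < 1" and \<theta>: "\<rho> / (1 - \<rho>) < \<theta>"
    and fin: "luxembourg_norm M \<theta> L0 < \<infinity>"
  shows "\<exists>c>0. \<forall>K Q L.
    conditional_versions P K \<longrightarrow> maximal_coupling_family K Q \<longrightarrow>
    common_law P L M L0 \<longrightarrow> controlled_by Q L \<psi> \<longrightarrow>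
    (\<forall>n\<ge>1. \<forall>g. local_fun n g \<longrightarrow> (\<forall>t>0.
       \<P>(\<sigma> in P. \<bar>g \<sigma> - (\<integral>\<eta>. g \<eta> \<partial>P)\<bar> > t)
         \<le> 4 * (if \<forall>j. variation g j = 0 then 0
                else exp (- c * (t powr \<rho> / ell2_norm (variation g) powr \<rho>)))))"
proof -
  interpret M: prob_space M by (rule M)
  note L0 [measurable]
  \<comment> \<open>Solves (2 - \<rho>) \<alpha> = \<rho>: at z = s^(2 - \<rho>) the function
    \<open>\<phi>\<close> below is then at least exp (k s^\<rho>).\<close>
  define \<alpha> where "\<alpha> = \<rho> / (2 - \<rho>)"
  \<comment> \<open>Solves 2 b \<alpha> = \<theta>, so that \<phi> (1 / w_j^2) is a stretched
    exponential in j of exponent \<open>\<theta>\<close>, matching the tail of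
    \<open>L0\<close>.\<close>
  define b where "b = \<theta> / (2 * \<alpha>)"
  define w where "w j = real (Suc j) powr (- b)" for j
  define r where "r j = measure M {\<omega> \<in> space M. of_nat j \<le> L0 \<omega>}" for j
  have \<alpha>: "0 < \<alpha>" "\<alpha> < 1" using \<rho> by (auto simp: \<alpha>_def)
  \<comment> \<open>The aim is 2 \<alpha> < \<theta>, that is b > 1, the summability of
    \<open>w\<close>.\<close>
  have "2 * \<alpha> = \<rho> / ((2 - \<rho>) / 2)" by (simp add: \<alpha>_def)
  also have "\<dots> < \<rho> / (1 - \<rho>)" using \<rho> by (intro divide_strict_left_mono mult_pos_pos) auto
  finally have "2 * \<alpha> < \<rho> / (1 - \<rho>)" .
  then have \<theta>': "2 * \<alpha> < \<theta>" "0 < \<theta>" using \<theta> \<alpha> by linarith+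
  have b: "1 < b" using \<theta>' \<alpha> by (simp add: b_def)
  obtain s0 where s0: "0 < s0" "(\<integral>\<^sup>+\<omega>. extend_ennreal (young_fun \<theta>) (L0 \<omega> / ennreal s0) \<partial>M) \<le> 1"
    using fin unfolding luxembourg_norm_def Inf_less_iff by auto
  \<comment> \<open>\<open>young_fun\<close> subtracts a constant; adding it back costs at most that
    constant because r j \<le> 1.\<close>
  define C0 where "C0 = 1 + exp (young_shift \<theta> powr \<theta>)"
  have C0: "0 < C0" by (simp add: C0_def add_pos_pos)
  have r_le: "r j * exp ((real j / s0) powr \<theta>) \<le> C0" for j
  proof -
    have "r j * young_fun \<theta> (real j / s0) \<le> 1"
      unfolding r_def
    proof (rule extend_ennreal_Markov[OF M young_fun_mono[OF \<theta>'(2)], where Z = "\<lambda>\<omega>. L0 \<omega> / ennreal s0"])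
      fix \<omega> assume "\<omega> \<in> {\<omega> \<in> space M. of_nat j \<le> L0 \<omega>}"
      then have "ennreal (real j) / ennreal s0 \<le> L0 \<omega> / ennreal s0"
        by (intro divide_right_mono_ennreal) (simp add: ennreal_of_nat_eq_real_of_nat)
      then show "ennreal (real j / s0) \<le> L0 \<omega> / ennreal s0" using s0 by (simp add: divide_ennreal)
    qed (use s0 \<theta>' in \<open>auto simp: young_fun_nonneg\<close>)
    moreover have "r j * exp (young_shift \<theta> powr \<theta>) \<le> 1 * exp (young_shift \<theta> powr \<theta>)"
      by (intro mult_right_mono) (auto simp: r_def)
    ultimately have "r j * exp ((\<bar>real j / s0\<bar> + young_shift \<theta>) powr \<theta>) \<le> C0"
      unfolding young_fun_def right_diff_distrib C0_def by linarith
    moreover have "r j * exp ((real j / s0) powr \<theta>) \<le> r j * exp ((\<bar>real j / s0\<bar> + young_shift \<theta>) powr \<theta>)"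
      using s0 \<theta>' young_shift_nonneg[of \<theta>] by (intro mult_left_mono) (auto simp: r_def intro!: powr_mono2)
    ultimately show ?thesis by linarith
  qed
  \<comment> \<open>The factor 2 absorbs the crude bound (x + h)^\<alpha> \<le> 2 (x^\<alpha> +
    h^\<alpha>), and the 2 inside the power absorbs the shift from j to j + 1; the growing part of
    the exponent then becomes exactly (j / s0)^\<theta>.\<close>
  define k where "k = 1 / (2 * (2 * s0) powr \<theta>)"
  have k: "0 < k" using s0 by (simp add: k_def)
  define \<kappa> where "\<kappa> = k powr (1 / \<alpha>)"
  \<comment> \<open>This shift makes \<open>\<phi>\<close> convex although \<alpha> < 1.\<close>
  define h where "h = young_shift \<alpha>"
  define \<phi> where "\<phi> y = exp ((\<kappa> * y + h) powr \<alpha>)" for y :: real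
  have \<kappa>: "0 < \<kappa>" "\<kappa> powr \<alpha> = k" using k \<alpha> by (simp_all add: \<kappa>_def powr_powr)
  have h: "0 < h" using young_shift_powr[OF \<alpha>] by (simp add: h_def)
  have \<phi>_pos: "0 < \<phi> y" for y by (simp add: \<phi>_def)
  have \<phi>_convex: "convex_on {0..} \<phi>"
    unfolding \<phi>_def[abs_def] h_def by (rule convex_on_exp_powr[OF \<alpha> \<kappa>(1)])
  have \<phi>_mono: "mono_on {0..} \<phi>"
  proof (rule mono_onI)
    fix x y :: real assume "x \<in> {0..}" "x \<le> y"
    then have "(\<kappa> * x + h) powr \<alpha> \<le> (\<kappa> * y + h) powr \<alpha>"
      using \<alpha>(1) \<kappa>(1) h by (intro powr_mono2 add_right_mono mult_left_mono) auto
    then show "\<phi> x \<le> \<phi> y" by (simp add: \<phi>_def)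
  qed
  define M0 where "M0 = C0 * exp (2 * k + 2 * h powr \<alpha>)"
  have M0: "r j * \<phi> ((1 / w j)\<^sup>2) \<le> M0" for j
  proof -
    have "1 / w j = real (Suc j) powr b" by (simp add: w_def powr_minus_divide)
    then have y: "(1 / w j)\<^sup>2 = real (Suc j) powr (2 * b)"
      by (simp add: power2_eq_square flip: powr_add)
    let ?y = "\<kappa> * real (Suc j) powr (2 * b)"
    have y\<alpha>: "?y powr \<alpha> = k * real (Suc j) powr \<theta>"
      using \<alpha> \<kappa> by (simp add: powr_mult powr_powr b_def)
    have y0: "0 \<le> ?y" using \<kappa> by simp
    have "(?y + h) powr \<alpha> \<le> (2 * max ?y h) powr \<alpha>"
      using y0 h \<alpha> by (intro powr_mono2) auto
    also have "\<dots> = 2 powr \<alpha> * max ?y h powr \<alpha>" using y0 h by (simp add: powr_mult)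
    also have "\<dots> \<le> 2 * (?y powr \<alpha> + h powr \<alpha>)"
      using \<alpha> powr_mono[of \<alpha> 1 2] by (intro mult_mono) (auto simp: max_def)
    also have "\<dots> \<le> 2 * (k * (1 + 2 powr \<theta> * real j powr \<theta>) + h powr \<alpha>)"
      unfolding y\<alpha> using k \<theta>' by (intro mult_left_mono add_right_mono Suc_powr_le) auto
    also have "\<dots> = (real j / s0) powr \<theta> + (2 * k + 2 * h powr \<alpha>)"
      using s0 by (simp add: k_def powr_mult powr_divide field_simps)
    finally have "r j * \<phi> ((1 / w j)\<^sup>2) \<le> r j * exp ((real j / s0) powr \<theta> + (2 * k + 2 * h powr \<alpha>))"
      unfolding y \<phi>_def by (intro mult_left_mono) (auto simp: r_def)
    also have "\<dots> = (r j * exp ((real j / s0) powr \<theta>)) * exp (2 * k + 2 * h powr \<alpha>)"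
      by (simp add: exp_add)
    also have "\<dots> \<le> M0" unfolding M0_def by (intro mult_right_mono r_le) simp
    finally show ?thesis .
  qed
  have w: "\<And>j. 0 < w j" "summable w"
    using summable_Suc_powr[OF b] by (auto simp: w_def[abs_def])
  have W: "0 < suminf w" using w by (intro suminf_pos) auto
  define c1 where "c1 = 1 / (8 * (suminf \<psi>)\<^sup>2 + 8 * (suminf w)\<^sup>2)"
  have c1: "0 < c1" using W by (auto simp: c1_def intro!: add_nonneg_pos)
  \<comment> \<open>The martingale term contributes 2 and the Markov term \<phi> 0 + M0, both at the
    common rate min c1 k.\<close>
  define N1 where "N1 = 2 + (\<phi> 0 + M0)"
  have M0_nonneg: "0 \<le> \<phi> 0 + M0" using C0 by (simp add: \<phi>_def M0_def)
  have "1 \<le> N1" "0 < min c1 k" using M0_nonneg c1 k by (auto simp: N1_def)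
  then obtain c where c: "0 < c" "\<And>u P. 0 < u \<Longrightarrow> P \<le> 1 \<Longrightarrow>
      (1 \<le> u \<Longrightarrow> P \<le> N1 * exp (- min c1 k * u)) \<Longrightarrow> P \<le> 4 * exp (- c * u)"
    using exp_bound_absorb_constant by metis
  show ?thesis
  proof (intro exI[of _ c] conjI allI impI c(1))
    fix K Q L n and g :: "(nat \<Rightarrow> 'a) \<Rightarrow> real" and t :: real
    assume ass: "conditional_versions P K" "maximal_coupling_family K Q" "common_law P L M L0"
      "controlled_by Q L \<psi>" and g: "local_fun n g" and t: "0 < t"
    let ?N = "ell2_norm (variation g)"
    show "\<P>(\<sigma> in P. \<bar>g \<sigma> - expectation g\<bar> > t)
        \<le> 4 * (if \<forall>j. variation g j = 0 then 0 else exp (- c * (t powr \<rho> / ?N powr \<rho>)))"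
    proof (cases "?N = 0")
      case True
      then show ?thesis using deviation_eq_0[OF g True t] by simp
    next
      case False
      then have N: "0 < ?N" using ell2_norm_variation(2)[OF g] by simp
      define s where "s = t / ?N"
      have s: "0 < s" "t = s * ?N" using N t by (simp_all add: s_def)
      have ratio: "t powr \<rho> / ?N powr \<rho> = s powr \<rho>" using t N by (simp add: s_def powr_divide)
      have "\<P>(\<sigma> in P. \<bar>g \<sigma> - expectation g\<bar> > t) \<le> 4 * exp (- c * s powr \<rho>)"
      proof (rule c(2))
        assume "1 \<le> s powr \<rho>"
        then have s1: "1 \<le> s" using s(1) \<rho> powr_less_mono2[of \<rho> s 1] by (cases "1 \<le> s") auto
        let ?z = "s powr (2 - \<rho>)" and ?u = "s powr \<rho>"
        have "\<P>(\<sigma> in P. \<bar>g \<sigma> - expectation g\<bar> > s * ?N)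
            \<le> 2 * exp (- s\<^sup>2 / (4 * (2 * (suminf \<psi>)\<^sup>2 + 2 * (suminf w)\<^sup>2 * ?z))) + (\<phi> 0 + M0) / \<phi> ?z"
          by (rule coupling_tail[OF ass(1-3) L0 ass(4) \<psi> w \<phi>_convex \<phi>_mono less_imp_le[OF \<phi>_pos]
                M0[unfolded r_def] _ \<phi>_pos g N s(1)]) (use s(1) in simp)
        also have "\<dots> \<le> 2 * exp (- min c1 k * ?u) + (\<phi> 0 + M0) * exp (- min c1 k * ?u)"
        proof (intro add_mono mult_left_mono)
          have "exp (- s\<^sup>2 / (4 * (2 * (suminf \<psi>)\<^sup>2 + 2 * (suminf w)\<^sup>2 * ?z))) \<le> exp (- c1 * ?u)"
            unfolding c1_def using W \<rho> by (intro subgaussian_term_le s1) auto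
          also have "\<dots> \<le> exp (- min c1 k * ?u)" by (simp add: mult_right_mono)
          finally show "exp (- s\<^sup>2 / (4 * (2 * (suminf \<psi>)\<^sup>2 + 2 * (suminf w)\<^sup>2 * ?z))) \<le> exp (- min c1 k * ?u)" .
          have "k * ?u = (\<kappa> * ?z) powr \<alpha>"
            using \<kappa> \<rho> by (simp add: powr_mult powr_powr \<alpha>_def)
          also have "\<dots> \<le> (\<kappa> * ?z + h) powr \<alpha>" using \<kappa> h \<alpha> by (intro powr_mono2) auto
          finally have "exp (k * ?u) \<le> \<phi> ?z" by (simp add: \<phi>_def)
          then have "(\<phi> 0 + M0) / \<phi> ?z \<le> (\<phi> 0 + M0) / exp (k * ?u)"
            using M0_nonneg by (intro divide_left_mono mult_pos_pos) (auto simp: \<phi>_def)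
          also have "\<dots> = (\<phi> 0 + M0) * exp (- k * ?u)" by (simp add: exp_minus divide_inverse)
          also have "\<dots> \<le> (\<phi> 0 + M0) * exp (- min c1 k * ?u)"
            using M0_nonneg by (intro mult_left_mono) (auto simp: mult_right_mono)
          finally show "(\<phi> 0 + M0) / \<phi> ?z \<le> (\<phi> 0 + M0) * exp (- min c1 k * ?u)" .
        qed simp
        finally show "\<P>(\<sigma> in P. \<bar>g \<sigma> - expectation g\<bar> > t) \<le> N1 * exp (- min c1 k * ?u)"
          unfolding s(2)[symmetric] N1_def by (simp add: distrib_right)
      qed (use s(1) in auto)
      moreover have "\<not> (\<forall>j. variation g j = 0)" using False ell2_norm_variation_eq_0_iff[OF g] by simp
      ultimately show ?thesis by (simp only: ratio if_False)
    qed
  qed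
qed

theorem proposition2:
  fixes P :: "(nat \<Rightarrow> 'a::finite) measure"
    and M :: "'b measure" and L0 :: "'b \<Rightarrow> ennreal"
    and \<psi> :: "nat \<Rightarrow> real"
  assumes "prob_space P" and "sets P = sets (coord_space UNIV)"
    and "prob_space M" and "L0 \<in> borel_measurable M"
    and "\<And>j. 0 \<le> \<psi> j"
  shows
    "(\<forall>p::nat. p \<ge> 1 \<longrightarrow>
        (\<exists>\<epsilon>>0. (\<integral>\<^sup>+\<omega>. extend_ennreal (\<lambda>x. x powr (2 * real p + \<epsilon>)) (L0 \<omega>) \<partial>M) < \<infinity>) \<longrightarrow>
        summable \<psi> \<longrightarrow>
        (\<exists>C>0. \<forall>K Q L.
           conditional_versions P K \<longrightarrow> maximal_coupling_family K Q \<longrightarrow>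
           common_law P L M L0 \<longrightarrow> controlled_by Q L \<psi> \<longrightarrow>
           (\<forall>n\<ge>1. \<forall>g. local_fun n g \<longrightarrow> (\<forall>t>0.
              \<P>(\<sigma> in P. \<bar>g \<sigma> - (\<integral>\<eta>. g \<eta> \<partial>P)\<bar> > t)
                \<le> C * (ell2_norm (variation g) ^ (2 * p) / t ^ (2 * p))))))
     \<and>
     (\<forall>\<rho> \<theta>::real. 0 < \<rho> \<longrightarrow> \<rho> < 1 \<longrightarrow>
        summable \<psi> \<longrightarrow> \<theta> > \<rho> / (1 - \<rho>) \<longrightarrow> luxembourg_norm M \<theta> L0 < \<infinity> \<longrightarrow>
        (\<exists>c>0. \<forall>K Q L.
           conditional_versions P K \<longrightarrow> maximal_coupling_family K Q \<longrightarrow>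
           common_law P L M L0 \<longrightarrow> controlled_by Q L \<psi> \<longrightarrow>
           (\<forall>n\<ge>1. \<forall>g. local_fun n g \<longrightarrow> (\<forall>t>0.
              \<P>(\<sigma> in P. \<bar>g \<sigma> - (\<integral>\<eta>. g \<eta> \<partial>P)\<bar> > t)
                \<le> 4 * (if \<forall>j. variation g j = 0 then 0
                       else exp (- c * (t powr \<rho> / ell2_norm (variation g) powr \<rho>)))))))"
proof -
  interpret finite_config_prob P
    using assms(1,2) by (simp add: finite_config_prob_def finite_config_prob_axioms_def)
  show ?thesis
  proof (intro conjI allI impI, goal_cases)
    case (1 p)
    then obtain \<epsilon> where "0 < \<epsilon>"
      "(\<integral>\<^sup>+\<omega>. extend_ennreal (\<lambda>x. x powr (2 * real p + \<epsilon>)) (L0 \<omega>) \<partial>M) < \<infinity>" by blast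
    from polynomial_tail[OF assms(3-5) 1(3,1) this] show ?case .
  next
    case (2 \<rho> \<theta>)
    from stretched_exponential_tail[OF assms(3-5) 2(3,1,2,4,5)] show ?case .
  qed
qed

end
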